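(* Let $\mathsf C$ be the variety of cancellative hoops. Then $K(\mathsf C)=\mathbf V(K(\mathbf C_\omega))$, and this variety is an atom of the lattice $\Lambda(\mathsf{KL})$ of subvarieties of $\mathsf{KL}$ which is not finitely generated (i.e. not generated by a finite algebra).
   Context: A commutative residuated lattice is $\langle A,\vee,\wedge,\cdot,\to,1\rangle$ where $\langle A,\vee,\wedge\rangle$ is a lattice, $\langle A,\cdot,1\rangle$ is a commutative monoid and $ab\le c$ iff $a\le b\to c$. It is integral if $1$ is the top element. $\mathsf{CIRL}$ is the variety of commutative integral residuated lattices. Put $\sim x:=x\to 1$. A K-lattice is a commutative residuated lattice that is $1$-involutive ($(x\to1)\to1= x$), $1$-distributive (both lattice distributive laws hold whenever at least one of the elements involved equals $1$) and satisfies (K1) $xy\wedge 1= (x\wedge1)(y\wedge1)$ and (K2) $((x\wedge1)\to y)\wedge((\sim y\wedge1)\to\sim x)= x\to y$. $\mathsf{KL}$ is the variety of K-lattices. For $\mathbf A\in\mathsf{CIRL}$, $K(\mathbf A)\in\mathsf{KL}$ has universe $A\times A$, unit $(1,1)$ and operations $(a,b)\vee(c,d)=(a\vee c,b\wedge d)$, $(a,b)\wedge(c,d)=(a\wedge c,b\vee d)$, $(a,b)(c,d)=(ac,(a\to d)\wedge(c\to b))$, $(a,b)\to(c,d)=((a\to c)\wedge(d\to b),ad)$. For a class $\mathcal V\subseteq\mathsf{CIRL}$, $K(\mathcal V)$ is the class of all $\mathbf A\in\mathsf{KL}$ that embed in $K(\mathbf L)$ for some $\mathbf L\in\mathcal V$.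 A hoop here is an algebra in $\mathsf{CIRL}$ satisfying $x(x\to y)= y(y\to x)$. It is cancellative if its monoid is cancellative, equivalently if $x\to xy= y$ holds. $\mathbf C_\omega$ is the cancellative hoop on the infinite chain $1=a^0>a>a^2>\cdots$ with $a^ra^s=a^{r+s}$ and $a^r\to a^s=a^{\max\{s-r,0\}}$. $\mathbf V(\cdot)$ denotes the generated variety. *)

theory Defs
  imports "HOL-Algebra.Group"
begin

section \<open>Residuated lattices\<close>

text \<open>
  The carrier, product and unit come from the monoid record of HOL-Algebra, so that the monoid
  axioms are those of its locale \<open>comm_monoid\<close>. Nothing is said about the operations outside
  the carrier.
\<close>

record 'a rl = "'a monoid" +
  vee :: "'a \<Rightarrow> 'a \<Rightarrow> 'a" (infixl "\<curlyvee>\<index>" 65)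
  wedge :: "'a \<Rightarrow> 'a \<Rightarrow> 'a" (infixl "\<curlywedge>\<index>" 66)
  resid :: "'a \<Rightarrow> 'a \<Rightarrow> 'a" (infixr "\<leadsto>\<index>" 63)

definition rl_le :: "('a, 'm) rl_scheme \<Rightarrow> 'a \<Rightarrow> 'a \<Rightarrow> bool" (infix "\<preceq>\<index>" 50) where
  "x \<preceq>\<^bsub>A\<^esub> y \<longleftrightarrow> x \<curlywedge>\<^bsub>A\<^esub> y = x"

text \<open>An arbitrary algebra in the signature: the carrier is closed under the operations.\<close>

definition rl_algebra :: "('a, 'm) rl_scheme \<Rightarrow> bool" where
  "rl_algebra A \<longleftrightarrow> \<one>\<^bsub>A\<^esub> \<in> carrier A \<and>
     (\<forall>x\<in>carrier A. \<forall>y\<in>carrier A.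
        x \<curlyvee>\<^bsub>A\<^esub> y \<in> carrier A \<and> x \<curlywedge>\<^bsub>A\<^esub> y \<in> carrier A \<and>
        x \<otimes>\<^bsub>A\<^esub> y \<in> carrier A \<and> x \<leadsto>\<^bsub>A\<^esub> y \<in> carrier A)"

locale comm_residuated_lattice = comm_monoid A for A (structure) +
  assumes vee_closed: "\<lbrakk>x \<in> carrier A; y \<in> carrier A\<rbrakk> \<Longrightarrow> x \<curlyvee> y \<in> carrier A"
    and wedge_closed: "\<lbrakk>x \<in> carrier A; y \<in> carrier A\<rbrakk> \<Longrightarrow> x \<curlywedge> y \<in> carrier A"
    and resid_closed: "\<lbrakk>x \<in> carrier A; y \<in> carrier A\<rbrakk> \<Longrightarrow> x \<leadsto> y \<in> carrier A"
    and vee_assoc: "\<lbrakk>x \<in> carrier A; y \<in> carrier A; z \<in> carrier A\<rbrakk>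
      \<Longrightarrow> (x \<curlyvee> y) \<curlyvee> z = x \<curlyvee> (y \<curlyvee> z)"
    and wedge_assoc: "\<lbrakk>x \<in> carrier A; y \<in> carrier A; z \<in> carrier A\<rbrakk>
      \<Longrightarrow> (x \<curlywedge> y) \<curlywedge> z = x \<curlywedge> (y \<curlywedge> z)"
    and vee_comm: "\<lbrakk>x \<in> carrier A; y \<in> carrier A\<rbrakk> \<Longrightarrow> x \<curlyvee> y = y \<curlyvee> x"
    and wedge_comm: "\<lbrakk>x \<in> carrier A; y \<in> carrier A\<rbrakk> \<Longrightarrow> x \<curlywedge> y = y \<curlywedge> x"
    and vee_absorb: "\<lbrakk>x \<in> carrier A; y \<in> carrier A\<rbrakk> \<Longrightarrow> x \<curlyvee> (x \<curlywedge> y) = x"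
    and wedge_absorb: "\<lbrakk>x \<in> carrier A; y \<in> carrier A\<rbrakk> \<Longrightarrow> x \<curlywedge> (x \<curlyvee> y) = x"
    and residuation: "\<lbrakk>x \<in> carrier A; y \<in> carrier A; z \<in> carrier A\<rbrakk>
      \<Longrightarrow> x \<otimes> y \<preceq> z \<longleftrightarrow> x \<preceq> y \<leadsto> z"

locale comm_integral_residuated_lattice = comm_residuated_lattice +
  assumes integral: "x \<in> carrier A \<Longrightarrow> x \<preceq> \<one>"

definition CIRL :: "'a rl set" where
  "CIRL = {A. comm_integral_residuated_lattice A}"

definition rl_neg :: "('a, 'm) rl_scheme \<Rightarrow> 'a \<Rightarrow> 'a" ("\<sim>\<index> _" [81] 80) where
  "\<sim>\<^bsub>A\<^esub> x = x \<leadsto>\<^bsub>A\<^esub> \<one>\<^bsub>A\<^esub>"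

locale K_lattice = comm_residuated_lattice +
  assumes one_involutive: "x \<in> carrier A \<Longrightarrow> \<sim> (\<sim> x) = x"
    and one_distributive_wedge:
      "\<lbrakk>x \<in> carrier A; y \<in> carrier A; z \<in> carrier A; x = \<one> \<or> y = \<one> \<or> z = \<one>\<rbrakk>
        \<Longrightarrow> x \<curlywedge> (y \<curlyvee> z) = (x \<curlywedge> y) \<curlyvee> (x \<curlywedge> z)"
    and one_distributive_vee:
      "\<lbrakk>x \<in> carrier A; y \<in> carrier A; z \<in> carrier A; x = \<one> \<or> y = \<one> \<or> z = \<one>\<rbrakk>
        \<Longrightarrow> x \<curlyvee> (y \<curlywedge> z) = (x \<curlyvee> y) \<curlywedge> (x \<curlyvee> z)"
    and K1: "\<lbrakk>x \<in> carrier A; y \<in> carrier A\<rbrakk>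
        \<Longrightarrow> (x \<otimes> y) \<curlywedge> \<one> = (x \<curlywedge> \<one>) \<otimes> (y \<curlywedge> \<one>)"
    and K2: "\<lbrakk>x \<in> carrier A; y \<in> carrier A\<rbrakk>
        \<Longrightarrow> ((x \<curlywedge> \<one>) \<leadsto> y) \<curlywedge> ((\<sim> y \<curlywedge> \<one>) \<leadsto> \<sim> x) = x \<leadsto> y"

definition KL :: "'a rl set" where
  "KL = {A. K_lattice A}"

section \<open>The construction K\<close>

definition K :: "'a rl \<Rightarrow> ('a \<times> 'a) rl" where
  "K A = \<lparr>carrier = carrier A \<times> carrier A,
     mult = (\<lambda>(a, b) (c, d). (a \<otimes>\<^bsub>A\<^esub> c, (a \<leadsto>\<^bsub>A\<^esub> d) \<curlywedge>\<^bsub>A\<^esub> (c \<leadsto>\<^bsub>A\<^esub> b))),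
     one = (\<one>\<^bsub>A\<^esub>, \<one>\<^bsub>A\<^esub>),
     vee = (\<lambda>(a, b) (c, d). (a \<curlyvee>\<^bsub>A\<^esub> c, b \<curlywedge>\<^bsub>A\<^esub> d)),
     wedge = (\<lambda>(a, b) (c, d). (a \<curlywedge>\<^bsub>A\<^esub> c, b \<curlyvee>\<^bsub>A\<^esub> d)),
     resid = (\<lambda>(a, b) (c, d). ((a \<leadsto>\<^bsub>A\<^esub> c) \<curlywedge>\<^bsub>A\<^esub> (d \<leadsto>\<^bsub>A\<^esub> b), a \<otimes>\<^bsub>A\<^esub> d))\<rparr>"

definition rl_hom :: "'a rl \<Rightarrow> 'b rl \<Rightarrow> ('a \<Rightarrow> 'b) set" where
  "rl_hom A B = {h. h \<in> carrier A \<rightarrow> carrier B \<and> h \<one>\<^bsub>A\<^esub> = \<one>\<^bsub>B\<^esub> \<and>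
     (\<forall>x\<in>carrier A. \<forall>y\<in>carrier A.
        h (x \<curlyvee>\<^bsub>A\<^esub> y) = h x \<curlyvee>\<^bsub>B\<^esub> h y \<and> h (x \<curlywedge>\<^bsub>A\<^esub> y) = h x \<curlywedge>\<^bsub>B\<^esub> h y \<and>
        h (x \<otimes>\<^bsub>A\<^esub> y) = h x \<otimes>\<^bsub>B\<^esub> h y \<and> h (x \<leadsto>\<^bsub>A\<^esub> y) = h x \<leadsto>\<^bsub>B\<^esub> h y)}"

definition embeds_in :: "'a rl \<Rightarrow> 'b rl \<Rightarrow> bool" where
  "embeds_in A B \<longleftrightarrow> (\<exists>h \<in> rl_hom A B. inj_on h (carrier A))"

text \<open>The image under K of a class; the members of the image may live on another type.\<close>

definition K_class :: "'b rl set \<Rightarrow> 'a rl set" where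
  "K_class V = {A \<in> KL. \<exists>L\<in>V. embeds_in A (K L)}"

section \<open>Cancellative hoops\<close>

definition hoops :: "'a rl set" where
  "hoops = {A \<in> CIRL. \<forall>x\<in>carrier A. \<forall>y\<in>carrier A.
     x \<otimes>\<^bsub>A\<^esub> (x \<leadsto>\<^bsub>A\<^esub> y) = y \<otimes>\<^bsub>A\<^esub> (y \<leadsto>\<^bsub>A\<^esub> x)}"

definition cancellative_hoops :: "'a rl set" where
  "cancellative_hoops = {A \<in> hoops. \<forall>x\<in>carrier A. \<forall>y\<in>carrier A. \<forall>z\<in>carrier A.
     x \<otimes>\<^bsub>A\<^esub> y = x \<otimes>\<^bsub>A\<^esub> z \<longrightarrow> y = z}"

text \<open>
  The number \<open>r\<close> stands for the power \<open>a\<^sup>r\<close>. Powers decrease as exponents increase, so joins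
  are minima of exponents. The subtraction is truncated, that is, \<open>s - r = max {s - r, 0}\<close>.
\<close>

definition C_omega :: "nat rl" where
  "C_omega = \<lparr>carrier = UNIV, mult = (+), one = 0,
     vee = min, wedge = max, resid = (\<lambda>r s. s - r)\<rparr>"

section \<open>Identities and varieties\<close>

datatype rl_term =
    Var nat
  | One
  | Vee rl_term rl_term
  | Wedge rl_term rl_term
  | Mult rl_term rl_term
  | Resid rl_term rl_term

primrec eval_term :: "'a rl \<Rightarrow> (nat \<Rightarrow> 'a) \<Rightarrow> rl_term \<Rightarrow> 'a" where
  "eval_term A v (Var n) = v n"
| "eval_term A v One = \<one>\<^bsub>A\<^esub>"
| "eval_term A v (Vee s t) = eval_term A v s \<curlyvee>\<^bsub>A\<^esub> eval_term A v t"
| "eval_term A v (Wedge s t) = eval_term A v s \<curlywedge>\<^bsub>A\<^esub> eval_term A v t"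
| "eval_term A v (Mult s t) = eval_term A v s \<otimes>\<^bsub>A\<^esub> eval_term A v t"
| "eval_term A v (Resid s t) = eval_term A v s \<leadsto>\<^bsub>A\<^esub> eval_term A v t"

definition satisfies :: "'a rl \<Rightarrow> rl_term \<times> rl_term \<Rightarrow> bool" where
  "satisfies A e \<longleftrightarrow>
     (\<forall>v. range v \<subseteq> carrier A \<longrightarrow> eval_term A v (fst e) = eval_term A v (snd e))"

definition models :: "(rl_term \<times> rl_term) set \<Rightarrow> 'a rl set" where
  "models E = {A. rl_algebra A \<and> (\<forall>e\<in>E. satisfies A e)}"

text \<open>
  Classes of algebras are taken relative to a type, whose subsets serve as carriers.
  Varieties are equational classes. (Closure under homomorphic images, subalgebras, and
  products would be too weak relative to a type: it would only concern those products that
  are small enough to fit into the type.)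
  If the type is infinite, it has room for the free algebra on countably many generators of
  every variety, so the equational classes over the type correspond bijectively to the
  equational theories.
\<close>

definition variety :: "'a rl set \<Rightarrow> bool" where
  "variety W \<longleftrightarrow> (\<exists>E. W = models E)"

text \<open>
  The intersection of all varieties containing \<open>A\<close>. The algebra \<open>A\<close> need not have the type of
  the members of the variety, which is why the varieties are given here by identities.
\<close>

definition generated_variety :: "'b rl \<Rightarrow> 'a rl set" where
  "generated_variety A = \<Inter> {models E | E. A \<in> models E}"

definition subvarieties :: "'a rl set \<Rightarrow> 'a rl set set" where
  "subvarieties V = {W. variety W \<and> W \<subseteq> V}"

text \<open>An atom of a family of sets ordered by inclusion: an element covering the least one.\<close>

definition atom_of :: "'c set set \<Rightarrow> 'c set \<Rightarrow> bool" where
  "atom_of F W \<longleftrightarrow> W \<in> F \<and>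
     (\<exists>B\<in>F. (\<forall>U\<in>F. B \<subseteq> U) \<and> B \<noteq> W \<and> (\<forall>U\<in>F. U \<subseteq> W \<longrightarrow> U = B \<or> U = W))"

end

theory Submission
  imports Complex_Main Defs "HOL-Algebra.FiniteProduct" "HOL-Library.Nat_Bijection"
begin

text \<open>
  The identities of \<open>K C_omega\<close> hold in \<open>K L\<close> for every cancellative hoop \<open>L\<close>, because finitely many
  elements of \<open>L\<close> can be mapped to \<open>C_omega\<close> by a map that respects all operations on them and
  separates two given elements. To find this map, choose a filter that is maximal among those
  omitting a residual \<open>a \<leadsto> b \<noteq> \<one>\<close>; by prelinearity it induces a total preorder compatible with
  the product, and a finite system of linear inequalities solvable in a totally ordered
  cancellative monoid is solvable in the integers (Fourier--Motzkin elimination).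

  Conversely, an algebra \<open>A\<close> satisfying the identities of \<open>K C_omega\<close> is isomorphic to \<open>K L\<close>, where \<open>L\<close>
  is its negative cone, by \<open>x \<mapsto> (x \<curlywedge> \<one>, \<sim> x \<curlywedge> \<one>)\<close>; that this is an isomorphism is
  itself expressed by identities, which need only be checked in \<open>K C_omega\<close>. If \<open>A\<close> is nontrivial,
  then so is \<open>L\<close>, and the powers of any \<open>a \<noteq> \<one>\<close> in \<open>L\<close> form a copy of \<open>C_omega\<close>. So \<open>K C_omega\<close> embeds
  in \<open>A\<close>, whence \<open>A\<close> is infinite and generates the whole variety.
\<close>

section \<open>Integer solutions of linear inequalities\<close>

definition plus_closed :: "('a \<Rightarrow> int) set \<Rightarrow> bool" where
  "plus_closed P \<longleftrightarrow> (\<forall>u\<in>P. \<forall>w\<in>P. (\<lambda>x. u x + w x) \<in> P)"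

lemma plus_closedD: "\<lbrakk>plus_closed P; u \<in> P; w \<in> P\<rbrakk> \<Longrightarrow> (\<lambda>x. u x + w x) \<in> P"
  by (simp add: plus_closed_def)

lemma plus_closed_scale:
  fixes k :: int
  assumes "plus_closed P" "u \<in> P" "k > 0"
  shows "(\<lambda>x. k * u x) \<in> P"
  using \<open>k > 0\<close>
proof (induction k rule: int_gr_induct)
  case base
  then show ?case using \<open>u \<in> P\<close> by simp
next
  case (step i)
  have "(\<lambda>x. i * u x + u x) \<in> P" using plus_closedD[OF assms(1) step.IH \<open>u \<in> P\<close>] .
  then show ?case by (simp add: algebra_simps)
qed

text \<open>Supplies the value of an eliminated variable from its lower and upper bounds. Either set
  of bounds may be empty.\<close>

lemma exists_between_finite:
  fixes A B :: "rat set"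
  assumes "finite A" "finite B" "\<forall>a\<in>A. \<forall>b\<in>B. a \<le> b"
  shows "\<exists>r. (\<forall>a\<in>A. a \<le> r) \<and> (\<forall>b\<in>B. r \<le> b)"
proof (cases "A = {}")
  case True
  then show ?thesis using assms(2) by (auto intro: Min_le)
next
  case False
  then show ?thesis using assms by (intro exI[of _ "Max A"]) simp
qed

text \<open>A pair \<open>(u, c)\<close> stands for the constraint \<open>\<Sum>x. u x * \<phi> x \<ge> c\<close>. Since solutions can be
  scaled, a positive \<open>c\<close> just encodes strictness.\<close>

definition admissible :: "('a \<Rightarrow> int) set \<Rightarrow> ('a \<Rightarrow> int) \<times> int \<Rightarrow> bool" where
  "admissible P C \<longleftrightarrow> 0 \<le> snd C \<and> fst C \<in> P \<and> (0 < snd C \<longrightarrow> (\<lambda>x. - fst C x) \<notin> P)"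

text \<open>Positive combinations of constraints are what elimination produces. If the combination
  is strict, then so is a summand, say \<open>u\<close>. Were the negated combination in
  \<open>P\<close>, adding \<open>b * w\<close> would put \<open>- (a * u)\<close> and hence
  \<open>- u\<close> into \<open>P\<close>, contrary to admissibility.\<close>

lemma admissible_combination:
  fixes P :: "('a \<Rightarrow> int) set"
  assumes add: "plus_closed P"
    and "admissible P (u, c)" "admissible P (w, d)" "a > 0" "b > 0"
  shows "admissible P (\<lambda>x. a * u x + b * w x, a * c + b * d)"
proof -
  note scale = plus_closed_scale[OF add] and add = plus_closedD[OF add]
  have u: "u \<in> P" "0 \<le> c" "0 < c \<Longrightarrow> (\<lambda>x. - u x) \<notin> P"
    and w: "w \<in> P" "0 \<le> d" "0 < d \<Longrightarrow> (\<lambda>x. - w x) \<notin> P"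
    using assms by (auto simp: admissible_def)
  have au: "(\<lambda>x. a * u x) \<in> P" by (rule scale[OF u(1) \<open>a > 0\<close>])
  have bw: "(\<lambda>x. b * w x) \<in> P" by (rule scale[OF w(1) \<open>b > 0\<close>])
  \<comment> \<open>A negated multiple can be divided by \<open>k\<close>: adding
    \<open>(k - 1) * z\<close>, which lies in \<open>P\<close>, to \<open>- (k * z)\<close> leaves
    \<open>- z\<close>. Scaling needs a positive factor, so \<open>k = 1\<close> is treated
    separately.\<close>
  have down: "(\<lambda>x. - z x) \<in> P" if "z \<in> P" "(\<lambda>x. - (k * z x)) \<in> P" "k > 0" for z and k :: int
  proof (cases "k = 1")
    case False
    then have "k - 1 > 0" using that by simp
    from scale[OF that(1) this] have "(\<lambda>x. (k - 1) * z x) \<in> P" .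
    from add[OF this that(2)] show ?thesis by (rule back_subst) (simp add: algebra_simps)
  qed (use that in auto)
  have "(\<lambda>x. - (a * u x + b * w x)) \<notin> P" if "0 < a * c + b * d"
  proof
    assume neg: "(\<lambda>x. - (a * u x + b * w x)) \<in> P"
    have "(\<lambda>x. - (a * u x)) \<in> P" using add[OF neg bw] by (rule back_subst) simp
    from down[OF u(1) this \<open>a > 0\<close>] have "\<not> 0 < c" using u(3) by blast
    moreover have "(\<lambda>x. - (b * w x)) \<in> P" using add[OF neg au] by (rule back_subst) simp
    from down[OF w(1) this \<open>b > 0\<close>] have "\<not> 0 < d" using w(3) by blast
    ultimately show False using u(2) w(2) that by simp
  qed
  then show ?thesis using add[OF au bw] u(2) w(2) assms(4,5) by (simp add: admissible_def)
qed

text \<open>Variables are eliminated one by one. A solution of the reduced system extends, because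
  the pairwise combinations say that every lower bound for the eliminated variable lies below every
  upper bound. With no variables left, a positive right-hand side would require the zero vector to
  lie outside \<open>P\<close>.\<close>

lemma linear_system_solvable_rat:
  fixes P :: "('a \<Rightarrow> int) set" and S :: "(('a \<Rightarrow> int) \<times> int) set"
  assumes add: "plus_closed P"
    and zero: "(\<lambda>x. 0) \<in> P"
    and "finite T" "finite S" "\<And>C. C \<in> S \<Longrightarrow> admissible P C"
    and "\<And>C x. \<lbrakk>C \<in> S; x \<notin> T\<rbrakk> \<Longrightarrow> fst C x = 0"
  shows "\<exists>\<phi> :: 'a \<Rightarrow> rat. \<forall>C\<in>S. of_int (snd C) \<le> (\<Sum>x\<in>T. of_int (fst C x) * \<phi> x)"
  using \<open>finite T\<close> assms(4-)
proof (induction T arbitrary: S)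
  case empty
  have "snd C \<le> 0" if "C \<in> S" for C
  proof -
    have "fst C = (\<lambda>x. 0)" using empty.prems(3)[OF that] by auto
    then show ?thesis using empty.prems(2)[OF that] zero by (auto simp: admissible_def)
  qed
  then show ?case by simp
next
  case (insert t T)
  define S0 where "S0 = {C \<in> S. fst C t = 0}"
  define Sp where "Sp = {C \<in> S. fst C t > 0}"
  define Sn where "Sn = {C \<in> S. fst C t < 0}"
  \<comment> \<open>Cross-multiplication cancels the coefficient of \<open>t\<close>. Both factors
    are positive for \<open>C\<close> in \<open>Sp\<close> and \<open>D\<close> in
    \<open>Sn\<close>, so admissibility is preserved.\<close>
  define comb where "comb = (\<lambda>(C :: ('a \<Rightarrow> int) \<times> int, D :: ('a \<Rightarrow> int) \<times> int).
    (\<lambda>x. (- fst D t) * fst C x + fst C t * fst D x, (- fst D t) * snd C + fst C t * snd D))"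
  define S' where "S' = S0 \<union> comb ` (Sp \<times> Sn)"
  have fin: "finite Sp" "finite Sn" "finite S'"
    using insert.prems(1) by (auto simp: S'_def S0_def Sp_def Sn_def)
  have "admissible P C" if "C \<in> S'" for C
  proof (cases "C \<in> S0")
    case False
    with that obtain D E where "D \<in> Sp" "E \<in> Sn" "C = comb (D, E)" by (auto simp: S'_def)
    then show ?thesis
      using admissible_combination[OF add, of "fst D" "snd D" "fst E" "snd E" "- fst E t" "fst D t"]
        insert.prems(2)[of D] insert.prems(2)[of E]
      by (simp add: comb_def Sp_def Sn_def)
  qed (use insert.prems(2) in \<open>simp add: S0_def\<close>)
  moreover have "fst C x = 0" if "C \<in> S'" "x \<notin> T" for C x
  proof (cases "x = t")
    case True
    then show ?thesis using that(1) by (auto simp: S'_def S0_def comb_def)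
  next
    case False
    then have vanish: "fst D x = 0" if "D \<in> S" for D
      using insert.prems(3)[OF that] \<open>x \<notin> T\<close> by simp
    show ?thesis
    proof (cases "C \<in> S0")
      case False
      with that(1) obtain D E where "D \<in> S" "E \<in> S" "C = comb (D, E)"
        by (auto simp: S'_def Sp_def Sn_def)
      then show ?thesis by (simp add: comb_def vanish)
    qed (simp add: S0_def vanish)
  qed
  ultimately obtain \<phi> :: "'a \<Rightarrow> rat"
    where \<phi>: "\<And>C. C \<in> S' \<Longrightarrow> of_int (snd C) \<le> (\<Sum>x\<in>T. of_int (fst C x) * \<phi> x)"
    using insert.IH[OF fin(3)] by blast
  define l where "l C = (\<Sum>x\<in>T. of_int (fst C x) * \<phi> x)" for C :: "('a \<Rightarrow> int) \<times> int"
  \<comment> \<open>The bound that \<open>C\<close> puts on the value at \<open>t\<close> once the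
    other values are fixed by \<open>\<phi>\<close>: a lower bound for \<open>C\<close> in
    \<open>Sp\<close>, an upper bound for \<open>C\<close> in \<open>Sn\<close>.\<close>
  define q where "q C = (of_int (snd C) - l C) / of_int (fst C t)" for C
  have "q C \<le> q D" if "C \<in> Sp" "D \<in> Sn" for C D
  proof -
    have "comb (C, D) \<in> S'" using that by (auto simp: S'_def)
    moreover have "(\<Sum>x\<in>T. of_int (fst (comb (C, D)) x) * \<phi> x)
        = of_int (- fst D t) * l C + of_int (fst C t) * l D"
      unfolding l_def sum_distrib_left sum.distrib[symmetric]
      by (rule sum.cong) (simp_all add: comb_def algebra_simps)
    ultimately have "of_int (- fst D t) * of_int (snd C) + of_int (fst C t) * of_int (snd D)
        \<le> of_int (- fst D t) * l C + of_int (fst C t) * l D"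
      using \<phi>[of "comb (C, D)"] by (simp add: comb_def)
    then have "of_int (- fst D t) * (of_int (snd C) - l C)
        \<le> of_int (fst C t) * (l D - of_int (snd D))"
      by (simp add: algebra_simps)
    moreover have "(of_int (fst C t) :: rat) > 0" "(of_int (fst D t) :: rat) < 0"
      using that by (auto simp: Sp_def Sn_def)
    ultimately show ?thesis
      unfolding q_def by (simp add: field_simps)
  qed
  then have "\<forall>a\<in>q ` Sp. \<forall>b\<in>q ` Sn. a \<le> b" by blast
  then have "\<exists>r. (\<forall>a\<in>q ` Sp. a \<le> r) \<and> (\<forall>b\<in>q ` Sn. r \<le> b)"
    by (rule exists_between_finite[OF fin(1,2)[THEN finite_imageI]])
  then obtain r where r: "\<And>C. C \<in> Sp \<Longrightarrow> q C \<le> r" "\<And>C. C \<in> Sn \<Longrightarrow> r \<le> q C" by auto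
  have "of_int (snd C) \<le> (\<Sum>x\<in>insert t T. of_int (fst C x) * (\<phi>(t := r)) x)" if C: "C \<in> S" for C
  proof -
    have eq: "(\<Sum>x\<in>insert t T. of_int (fst C x) * (\<phi>(t := r)) x) = of_int (fst C t) * r + l C"
      unfolding l_def using insert.hyps by (auto intro!: sum.cong)
    consider "C \<in> S0" | "C \<in> Sp" | "C \<in> Sn"
      using C less_linear[of "fst C t" 0] unfolding S0_def Sp_def Sn_def by blast
    then show ?thesis
    proof cases
      case 1
      then show ?thesis unfolding eq using \<phi>[of C] by (auto simp: S'_def l_def S0_def)
    next
      case 2
      have "(of_int (fst C t) :: rat) > 0" using 2 by (auto simp: Sp_def)
      then show ?thesis unfolding eq using r(1)[OF 2] by (simp add: q_def field_simps)
    next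
      case 3
      have "(of_int (fst C t) :: rat) < 0" using 3 by (auto simp: Sn_def)
      then show ?thesis unfolding eq using r(2)[OF 3] by (simp add: q_def field_simps)
    qed
  qed
  then show ?case by blast
qed

lemma common_denominator:
  fixes \<phi> :: "'a \<Rightarrow> rat"
  assumes "finite T"
  obtains N :: int and \<psi> :: "'a \<Rightarrow> int"
  where "N > 0" "\<And>x. x \<in> T \<Longrightarrow> of_int (\<psi> x) = of_int N * \<phi> x"
  using assms
proof (induction T arbitrary: thesis rule: finite_induct)
  case empty
  then show ?case using empty.prems[of 1] by simp
next
  case (insert t T)
  obtain N \<psi> where N: "N > 0" "\<And>x. x \<in> T \<Longrightarrow> of_int (\<psi> x) = of_int N * \<phi> x"
    using insert.IH by blast
  obtain a b where ab: "\<phi> t = of_int a / of_int b" "b > 0"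
    by (metis quotient_of_denom_pos' quotient_of_div surj_pair snd_conv)
  show ?case
    by (rule insert.prems[of "N * b" "(\<lambda>x. b * \<psi> x)(t := N * a)"])
      (use N ab insert.hyps in \<open>auto simp: field_simps\<close>)
qed

text \<open>Fourier--Motzkin elimination. The total cone \<open>P\<close> plays the role of a point of a totally
  ordered abelian group at which the inequalities are known to hold.\<close>

lemma linear_system_solvable_int:
  fixes P :: "('a \<Rightarrow> int) set"
  assumes add: "plus_closed P"
    and total: "\<forall>u. u \<in> P \<or> (\<lambda>x. - u x) \<in> P"
    and T: "finite T" and W: "finite W" "W \<subseteq> P" "\<forall>u\<in>W. \<forall>x. x \<notin> T \<longrightarrow> u x = 0"
    and u0: "u0 \<notin> P" "\<forall>x. x \<notin> T \<longrightarrow> u0 x = 0"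
  shows "\<exists>\<psi> :: 'a \<Rightarrow> int. (\<forall>u\<in>W. 0 \<le> (\<Sum>x\<in>T. u x * \<psi> x)) \<and> (\<Sum>x\<in>T. u0 x * \<psi> x) < 0"
proof -
  \<comment> \<open>The right-hand side 1 forces the sum for \<open>u0\<close> to be negative. This
    constraint is admissible: \<open>- u0\<close> lies in \<open>P\<close> by totality, while its
    negative \<open>u0\<close> does not.\<close>
  define S :: "(('a \<Rightarrow> int) \<times> int) set"
    where "S = insert (\<lambda>x. - u0 x, 1) ((\<lambda>u. (u, 0)) ` W)"
  have zero: "(\<lambda>x. 0) \<in> P" using total[rule_format, of "\<lambda>x. 0"] by simp
  have "admissible P C" if "C \<in> S" for C
    using that W(2) total[rule_format, of u0] u0(1) by (auto simp: S_def admissible_def)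
  moreover have "fst C x = 0" if "C \<in> S" "x \<notin> T" for C x
    using that W(3) u0(2) by (auto simp: S_def)
  moreover have "finite S" using W(1) by (simp add: S_def)
  ultimately obtain \<phi> :: "'a \<Rightarrow> rat"
    where \<phi>: "\<And>C. C \<in> S \<Longrightarrow> of_int (snd C) \<le> (\<Sum>x\<in>T. of_int (fst C x) * \<phi> x)"
    using linear_system_solvable_rat[of P T S, OF add zero T] by blast
  obtain N \<psi> where N: "N > 0" "\<And>x. x \<in> T \<Longrightarrow> of_int (\<psi> x) = of_int N * \<phi> x"
    using common_denominator[OF T] by blast
  have scaled: "(of_int (\<Sum>x\<in>T. u x * \<psi> x) :: rat) = of_int N * (\<Sum>x\<in>T. of_int (u x) * \<phi> x)" for u
    using N(2) by (simp add: sum_distrib_left mult.left_commute)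
  show ?thesis
  proof (intro exI conjI ballI)
    fix u assume "u \<in> W"
    then have "0 \<le> (\<Sum>x\<in>T. of_int (u x) * \<phi> x)" using \<phi>[of "(u, 0)"] by (simp add: S_def)
    then have "0 \<le> (of_int (\<Sum>x\<in>T. u x * \<psi> x) :: rat)" unfolding scaled using N(1) by simp
    then show "0 \<le> (\<Sum>x\<in>T. u x * \<psi> x)" by linarith
  next
    have "1 \<le> - (\<Sum>x\<in>T. of_int (u0 x) * \<phi> x)"
      using \<phi>[of "(\<lambda>x. - u0 x, 1)"] by (simp add: S_def sum_negf)
    then have "(of_int (\<Sum>x\<in>T. u0 x * \<psi> x) :: rat) < 0"
      unfolding scaled using N(1) by (simp add: mult_pos_neg)
    then show "(\<Sum>x\<in>T. u0 x * \<psi> x) < 0" by linarith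
  qed
qed

section \<open>Cancellative hoops and total filters\<close>

context comm_residuated_lattice
begin

lemma wedge_idem: "x \<in> carrier A \<Longrightarrow> x \<curlywedge> x = x"
  by (metis vee_absorb vee_closed wedge_absorb)

lemma le_refl: "x \<in> carrier A \<Longrightarrow> x \<preceq> x"
  by (simp add: rl_le_def wedge_idem)

lemma le_trans:
  "\<lbrakk>x \<preceq> y; y \<preceq> z; x \<in> carrier A; y \<in> carrier A; z \<in> carrier A\<rbrakk> \<Longrightarrow> x \<preceq> z"
  unfolding rl_le_def by (metis wedge_assoc)

lemma le_antisym: "\<lbrakk>x \<preceq> y; y \<preceq> x; x \<in> carrier A; y \<in> carrier A\<rbrakk> \<Longrightarrow> x = y"
  unfolding rl_le_def by (metis wedge_comm)

lemma wedge_lower1: "\<lbrakk>x \<in> carrier A; y \<in> carrier A\<rbrakk> \<Longrightarrow> x \<curlywedge> y \<preceq> x"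
  unfolding rl_le_def by (metis wedge_assoc wedge_comm wedge_idem)

lemma wedge_lower2: "\<lbrakk>x \<in> carrier A; y \<in> carrier A\<rbrakk> \<Longrightarrow> x \<curlywedge> y \<preceq> y"
  by (metis wedge_comm wedge_lower1)

lemma wedge_greatest:
  "\<lbrakk>z \<preceq> x; z \<preceq> y; x \<in> carrier A; y \<in> carrier A; z \<in> carrier A\<rbrakk> \<Longrightarrow> z \<preceq> x \<curlywedge> y"
  unfolding rl_le_def by (metis wedge_assoc)

lemma le_iff_vee: "\<lbrakk>x \<in> carrier A; y \<in> carrier A\<rbrakk> \<Longrightarrow> x \<preceq> y \<longleftrightarrow> x \<curlyvee> y = y"
  unfolding rl_le_def by (metis vee_absorb wedge_absorb vee_comm wedge_comm)

lemma vee_upper1: "\<lbrakk>x \<in> carrier A; y \<in> carrier A\<rbrakk> \<Longrightarrow> x \<preceq> x \<curlyvee> y"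
  unfolding rl_le_def by (rule wedge_absorb)

lemma vee_upper2: "\<lbrakk>x \<in> carrier A; y \<in> carrier A\<rbrakk> \<Longrightarrow> y \<preceq> x \<curlyvee> y"
  by (metis vee_comm vee_upper1)

lemma vee_least:
  "\<lbrakk>x \<preceq> z; y \<preceq> z; x \<in> carrier A; y \<in> carrier A; z \<in> carrier A\<rbrakk> \<Longrightarrow> x \<curlyvee> y \<preceq> z"
  by (metis le_iff_vee vee_assoc vee_closed)

lemma resid_mult_le: "\<lbrakk>x \<in> carrier A; y \<in> carrier A\<rbrakk> \<Longrightarrow> x \<otimes> (x \<leadsto> y) \<preceq> y"
  by (metis le_refl m_comm resid_closed residuation)

lemma one_resid: "x \<in> carrier A \<Longrightarrow> \<one> \<leadsto> x = x"
  using resid_mult_le[of \<one> x] residuation[of x \<one> x]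
  by (intro le_antisym) (simp_all add: le_refl resid_closed)

lemma mult_mono_left:
  assumes "x \<preceq> y" "x \<in> carrier A" "y \<in> carrier A" "z \<in> carrier A"
  shows "x \<otimes> z \<preceq> y \<otimes> z"
proof -
  have "y \<preceq> z \<leadsto> y \<otimes> z" using assms by (simp add: le_refl flip: residuation)
  then have "x \<preceq> z \<leadsto> y \<otimes> z" using assms le_trans[of x y] by (simp add: resid_closed)
  then show ?thesis using assms by (simp add: residuation)
qed

lemma mult_mono:
  assumes "x \<preceq> y" "z \<preceq> w" "x \<in> carrier A" "y \<in> carrier A" "z \<in> carrier A" "w \<in> carrier A"
  shows "x \<otimes> z \<preceq> y \<otimes> w"
proof -
  have "x \<otimes> z \<preceq> y \<otimes> z" using assms mult_mono_left by blast
  moreover have "y \<otimes> z \<preceq> y \<otimes> w" using assms mult_mono_left[of z w y] by (simp add: m_comm)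
  ultimately show ?thesis using assms le_trans[of "x \<otimes> z" "y \<otimes> z" "y \<otimes> w"] by simp
qed

lemma mult_vee_le:
  assumes "x \<otimes> z \<preceq> w" "y \<otimes> z \<preceq> w" "x \<in> carrier A" "y \<in> carrier A" "z \<in> carrier A" "w \<in> carrier A"
  shows "(x \<curlyvee> y) \<otimes> z \<preceq> w"
  using assms vee_least[of x "z \<leadsto> w" y] by (simp add: residuation vee_closed resid_closed)

lemma rl_algebra: "rl_algebra A"
  unfolding rl_algebra_def using vee_closed wedge_closed resid_closed by simp

end

section \<open>Consequences of integrality\<close>

context comm_integral_residuated_lattice
begin

lemma le_iff_resid: "\<lbrakk>x \<in> carrier A; y \<in> carrier A\<rbrakk> \<Longrightarrow> x \<preceq> y \<longleftrightarrow> x \<leadsto> y = \<one>"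
  by (metis integral l_one le_antisym le_refl one_closed resid_closed residuation)

lemma mult_le1: "\<lbrakk>x \<in> carrier A; y \<in> carrier A\<rbrakk> \<Longrightarrow> x \<otimes> y \<preceq> x"
  using mult_mono[of x x y \<one>] by (simp add: integral le_refl)

lemma mult_le2: "\<lbrakk>x \<in> carrier A; y \<in> carrier A\<rbrakk> \<Longrightarrow> x \<otimes> y \<preceq> y"
  by (metis m_comm mult_le1)

text \<open>The join lies above \<open>x \<otimes> y\<close> and \<open>z \<otimes> y\<close>, hence
  above \<open>(x \<curlyvee> z) \<otimes> y = y\<close>, hence above
  \<open>x \<curlyvee> y = \<one>\<close>.\<close>

lemma vee_mult_eq_one:
  assumes "x \<curlyvee> y = \<one>" "x \<curlyvee> z = \<one>" "x \<in> carrier A" "y \<in> carrier A" "z \<in> carrier A"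
  shows "x \<curlyvee> y \<otimes> z = \<one>"
proof -
  let ?r = "x \<curlyvee> y \<otimes> z"
  have r: "?r \<in> carrier A" "x \<preceq> ?r" "y \<otimes> z \<preceq> ?r"
    using assms by (simp_all add: vee_closed vee_upper1 vee_upper2)
  have "x \<otimes> y \<preceq> ?r" using assms r mult_le1[of x y] le_trans by (meson m_closed)
  moreover have "z \<otimes> y \<preceq> ?r" using assms r by (simp add: m_comm)
  ultimately have "(x \<curlyvee> z) \<otimes> y \<preceq> ?r" using assms r mult_vee_le by blast
  then have "y \<preceq> ?r" using assms by simp
  then have "\<one> \<preceq> ?r" using assms r vee_least[of x ?r y] by simp
  then show ?thesis using r integral le_antisym by blast
qed

lemma vee_pow_eq_one:
  assumes "x \<curlyvee> y = \<one>" "x \<in> carrier A" "y \<in> carrier A"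
  shows "x \<curlyvee> y [^] (n::nat) = \<one>"
proof (induction n)
  case 0
  then show ?case using assms integral[of x] by (simp add: le_iff_vee)
next
  case (Suc n)
  then show ?case using vee_mult_eq_one[of x "y [^] n" y] assms by simp
qed

end

section \<open>Cancellative hoops: divisibility, cancellation in the order, prelinearity\<close>

locale cancellative_hoop = comm_integral_residuated_lattice +
  assumes hoop: "\<lbrakk>x \<in> carrier A; y \<in> carrier A\<rbrakk> \<Longrightarrow> x \<otimes> (x \<leadsto> y) = y \<otimes> (y \<leadsto> x)"
    and cancel: "\<lbrakk>x \<otimes> y = x \<otimes> z; x \<in> carrier A; y \<in> carrier A; z \<in> carrier A\<rbrakk> \<Longrightarrow> y = z"

lemma mem_cancellative_hoops: "A \<in> cancellative_hoops \<longleftrightarrow> cancellative_hoop A"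
  unfolding cancellative_hoops_def hoops_def CIRL_def cancellative_hoop_def
    cancellative_hoop_axioms_def by blast

context cancellative_hoop
begin

text \<open>Divisibility: on one side of the hoop identity the residual
  \<open>x \<leadsto> y\<close> is \<open>\<one>\<close>.\<close>

lemma mult_resid_eq:
  assumes "x \<preceq> y" "x \<in> carrier A" "y \<in> carrier A"
  shows "y \<otimes> (y \<leadsto> x) = x"
  using assms hoop[of x y] by (simp add: le_iff_resid[THEN iffD1])

text \<open>By divisibility \<open>x \<otimes> z\<close> is a multiple of
  \<open>y \<otimes> z\<close>; cancelling \<open>z\<close> makes \<open>x\<close> a multiple of
  \<open>y\<close>, and multiples lie below by integrality.\<close>

lemma le_mult_cancel:
  assumes "x \<otimes> z \<preceq> y \<otimes> z" "x \<in> carrier A" "y \<in> carrier A" "z \<in> carrier A"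
  shows "x \<preceq> y"
proof -
  let ?r = "y \<otimes> z \<leadsto> x \<otimes> z"
  have r: "?r \<in> carrier A" using assms by (simp add: resid_closed)
  have "(y \<otimes> z) \<otimes> ?r = x \<otimes> z" using assms by (intro mult_resid_eq) auto
  then have "z \<otimes> (y \<otimes> ?r) = z \<otimes> x" using assms r by (simp add: m_ac)
  then have "y \<otimes> ?r = x" using assms r cancel by blast
  then show ?thesis using mult_le1[of y ?r] assms r by simp
qed

text \<open>Writing \<open>r\<close> for the join, \<open>x \<leadsto> y = r p\<close> and \<open>y \<leadsto> x = r q\<close>, and cancelling \<open>r\<close> from
  \<open>x r p = y r q\<close> gives \<open>p \<preceq> x \<leadsto> y\<close>, so that \<open>r p = p\<close>.\<close>

lemma prelinear:
  assumes x: "x \<in> carrier A" and y: "y \<in> carrier A"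
  shows "(x \<leadsto> y) \<curlyvee> (y \<leadsto> x) = \<one>"
proof -
  let ?r = "(x \<leadsto> y) \<curlyvee> (y \<leadsto> x)"
  define p where "p = ?r \<leadsto> (x \<leadsto> y)"
  define q where "q = ?r \<leadsto> (y \<leadsto> x)"
  have c: "x \<leadsto> y \<in> carrier A" "y \<leadsto> x \<in> carrier A" "?r \<in> carrier A" "p \<in> carrier A" "q \<in> carrier A"
    using x y by (simp_all add: p_def q_def resid_closed vee_closed)
  have p: "?r \<otimes> p = x \<leadsto> y" and q: "?r \<otimes> q = y \<leadsto> x"
    unfolding p_def q_def using c by (simp_all add: mult_resid_eq vee_upper1 vee_upper2)
  have "x \<otimes> (?r \<otimes> p) = y \<otimes> (?r \<otimes> q)" unfolding p q using hoop x y .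
  then have "?r \<otimes> (x \<otimes> p) = ?r \<otimes> (y \<otimes> q)" using c x y by (simp add: m_lcomm)
  then have "x \<otimes> p = y \<otimes> q" using c x y cancel by blast
  then have "p \<otimes> x \<preceq> y" using c x y mult_le1[of y q] by (simp add: m_comm)
  then have "p \<preceq> ?r \<otimes> p" unfolding p using c x y by (simp add: residuation)
  then have "p \<otimes> ?r = p \<otimes> \<one>" using c mult_le2[of ?r p] le_antisym by (simp add: m_comm)
  then show ?thesis using c cancel by blast
qed

text \<open>By divisibility the meet \<open>z\<close> equals
  \<open>x \<otimes> (x \<leadsto> z)\<close>, and
  \<open>x \<leadsto> z \<preceq> x \<leadsto> y\<close> because
  \<open>z \<preceq> y\<close>.\<close>

lemma wedge_eq: "\<lbrakk>x \<in> carrier A; y \<in> carrier A\<rbrakk> \<Longrightarrow> x \<curlywedge> y = x \<otimes> (x \<leadsto> y)"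
proof (rule le_antisym)
  assume c: "x \<in> carrier A" "y \<in> carrier A"
  let ?z = "x \<curlywedge> y"
  have z: "?z \<in> carrier A" "?z \<preceq> x" "?z \<preceq> y"
    using c by (simp_all add: wedge_closed wedge_lower1 wedge_lower2)
  have "(x \<leadsto> ?z) \<otimes> x \<preceq> y" using mult_resid_eq[of ?z x] z c by (simp add: m_comm resid_closed)
  then have "x \<leadsto> ?z \<preceq> x \<leadsto> y" using c z by (simp add: residuation resid_closed)
  then have "x \<otimes> (x \<leadsto> ?z) \<preceq> x \<otimes> (x \<leadsto> y)" using c z by (simp add: mult_mono le_refl resid_closed)
  then show "?z \<preceq> x \<otimes> (x \<leadsto> y)" using mult_resid_eq[of ?z x] z c by simp
  show "x \<otimes> (x \<leadsto> y) \<preceq> ?z"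
    using c by (simp add: wedge_greatest mult_le1 resid_mult_le resid_closed)
qed (simp_all add: wedge_closed resid_closed)

text \<open>Order cancellation seen through residuation. It makes the preorder modulo any filter
  cancellative.\<close>

lemma resid_mult_cancel:
  assumes "x \<in> carrier A" "y \<in> carrier A" "z \<in> carrier A"
  shows "x \<otimes> z \<leadsto> y \<otimes> z = x \<leadsto> y"
proof (rule le_antisym)
  let ?r = "x \<otimes> z \<leadsto> y \<otimes> z"
  have r: "?r \<in> carrier A" using assms by (simp add: resid_closed)
  have "(?r \<otimes> x) \<otimes> z \<preceq> y \<otimes> z" using resid_mult_le[of "x \<otimes> z" "y \<otimes> z"] assms r by (simp add: m_ac)
  then have "?r \<otimes> x \<preceq> y" using assms r le_mult_cancel by blast
  then show "?r \<preceq> x \<leadsto> y" using assms r by (simp add: residuation)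
  have "(x \<leadsto> y) \<otimes> x \<preceq> y" using resid_mult_le[of x y] assms by (simp add: m_comm resid_closed)
  then have "(x \<leadsto> y) \<otimes> x \<otimes> z \<preceq> y \<otimes> z" using assms by (simp add: mult_mono_left resid_closed)
  then show "x \<leadsto> y \<preceq> ?r" using assms by (simp add: m_assoc resid_closed flip: residuation)
qed (use assms in \<open>simp_all add: resid_closed\<close>)

end

section \<open>Filters and maximal filters omitting an element\<close>

definition rl_filter :: "('a, 'm) rl_scheme \<Rightarrow> 'a set \<Rightarrow> bool" where
  "rl_filter A F \<longleftrightarrow> F \<subseteq> carrier A \<and> \<one>\<^bsub>A\<^esub> \<in> F \<and> (\<forall>x\<in>F. \<forall>y\<in>F. x \<otimes>\<^bsub>A\<^esub> y \<in> F) \<and>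
     (\<forall>x\<in>F. \<forall>y\<in>carrier A. x \<preceq>\<^bsub>A\<^esub> y \<longrightarrow> y \<in> F)"

context comm_integral_residuated_lattice
begin

text \<open>Zorn's lemma, started from the filter \<open>{\<one>}\<close>, which omits
  \<open>p\<close>. The union of a chain is closed under products since any two of its elements lie
  in a common member.\<close>

lemma ex_maximal_filter:
  assumes "p \<in> carrier A" "p \<noteq> \<one>"
  obtains F where "rl_filter A F" "p \<notin> F" "\<And>G. \<lbrakk>rl_filter A G; p \<notin> G; F \<subseteq> G\<rbrakk> \<Longrightarrow> G = F"
proof -
  let ?S = "{F. rl_filter A F \<and> p \<notin> F}"
  have "{\<one>} \<in> ?S" using assms integral le_antisym by (auto simp: rl_filter_def)
  then have "?S \<noteq> {}" by blast
  moreover have "\<Union>C \<in> ?S" if C: "C \<noteq> {}" "subset.chain ?S C" for C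
  proof -
    have f: "\<And>F. F \<in> C \<Longrightarrow> rl_filter A F \<and> p \<notin> F" using C by (auto simp: subset.chain_def)
    have "x \<otimes> y \<in> \<Union>C" if xy: "x \<in> \<Union>C" "y \<in> \<Union>C" for x y
    proof -
      obtain F G where FG: "F \<in> C" "G \<in> C" "x \<in> F" "y \<in> G" using xy by blast
      then consider "F \<subseteq> G" | "G \<subseteq> F" using C by (meson subset_chain_def)
      then show ?thesis using FG f unfolding rl_filter_def by cases blast+
    qed
    then show ?thesis using f C(1) unfolding rl_filter_def by blast
  qed
  ultimately obtain F where "F \<in> ?S" "\<forall>G\<in>?S. F \<subseteq> G \<longrightarrow> G = F"
    using subset_Zorn_nonempty[of ?S] by meson
  then show ?thesis using that[of F] by auto
qed

text \<open>\<open>G\<close> is the filter generated by \<open>F\<close> and \<open>a\<close>.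
  Arbitrary powers of \<open>a\<close> give closure under products; exponent 0 recovers
  \<open>F\<close>, exponent 1 gives \<open>a\<close>.\<close>

lemma filter_insert:
  assumes F: "rl_filter A F" and a: "a \<in> carrier A"
  defines "G \<equiv> {z \<in> carrier A. \<exists>f\<in>F. \<exists>n::nat. f \<otimes> a [^] n \<preceq> z}"
  shows "rl_filter A G" "F \<subseteq> G" "a \<in> G"
proof -
  have Fc: "F \<subseteq> carrier A" and F1: "\<one> \<in> F" using F by (auto simp: rl_filter_def)
  have mult: "x \<otimes> y \<in> G" if "x \<in> G" "y \<in> G" for x y
  proof -
    obtain f g and m n :: nat where fg: "f \<in> F" "g \<in> F" "f \<otimes> a [^] m \<preceq> x" "g \<otimes> a [^] n \<preceq> y"
      "x \<in> carrier A" "y \<in> carrier A" using \<open>x \<in> G\<close> \<open>y \<in> G\<close> by (auto simp: G_def)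
    have c: "f \<in> carrier A" "g \<in> carrier A" using fg Fc by auto
    have "(f \<otimes> a [^] m) \<otimes> (g \<otimes> a [^] n) = (f \<otimes> g) \<otimes> a [^] (m + n)"
      using c a by (simp add: m_ac nat_pow_mult[symmetric])
    then have "(f \<otimes> g) \<otimes> a [^] (m + n) \<preceq> x \<otimes> y"
      using mult_mono[OF fg(3,4)] c a fg by simp
    moreover have "f \<otimes> g \<in> F" using F fg by (simp add: rl_filter_def)
    ultimately show ?thesis using fg by (auto simp: G_def)
  qed
  have up: "y \<in> G" if "x \<in> G" "y \<in> carrier A" "x \<preceq> y" for x y
    using that a Fc le_trans unfolding G_def mem_Collect_eq
    by (meson m_closed nat_pow_closed subsetD)
  show sub: "F \<subseteq> G"
  proof
    fix x assume "x \<in> F"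
    then have "x \<otimes> a [^] (0::nat) \<preceq> x" using Fc by (auto simp: le_refl)
    then show "x \<in> G" using \<open>x \<in> F\<close> Fc unfolding G_def by blast
  qed
  have "G \<subseteq> carrier A" by (auto simp: G_def)
  then show "rl_filter A G" unfolding rl_filter_def using sub F1 mult up by (metis subsetD)
  have "\<one> \<otimes> a [^] (1::nat) \<preceq> a" using a by (simp add: le_refl)
  then show "a \<in> G" using F1 a unfolding G_def by blast
qed

end

section \<open>The total preorder modulo a filter\<close>

locale total_filter = cancellative_hoop +
  fixes F
  assumes filter: "rl_filter A F"
    and total: "\<lbrakk>x \<in> carrier A; y \<in> carrier A\<rbrakk> \<Longrightarrow> x \<leadsto> y \<in> F \<or> y \<leadsto> x \<in> F"

text \<open>A maximal filter omitting \<open>p\<close> works. If it contained neither residual, then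
  \<open>f \<otimes> (x \<leadsto> y) [^] m\<close> and
  \<open>g \<otimes> (y \<leadsto> x) [^] n\<close> would lie below \<open>p\<close> for some
  \<open>f\<close> and \<open>g\<close> in it. By prelinearity the two powers have join
  \<open>\<one>\<close>, so \<open>f \<otimes> g \<preceq> p\<close>, which would put
  \<open>p\<close> into the filter.\<close>

lemma (in cancellative_hoop) ex_total_filter:
  assumes p: "p \<in> carrier A" "p \<noteq> \<one>"
  obtains F where "total_filter A F" "p \<notin> F"
proof -
  obtain F where F: "rl_filter A F" "p \<notin> F"
    and max: "\<And>G. \<lbrakk>rl_filter A G; p \<notin> G; F \<subseteq> G\<rbrakk> \<Longrightarrow> G = F"
    using ex_maximal_filter[OF p] by blast
  have Fc: "F \<subseteq> carrier A" using F by (simp add: rl_filter_def)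
  \<comment> \<open>By maximality the filter generated by \<open>F\<close> and \<open>a\<close>
    contains \<open>p\<close>.\<close>
  have below: "\<exists>f\<in>F. \<exists>n::nat. f \<otimes> a [^] n \<preceq> p" if "a \<in> carrier A" "a \<notin> F" for a
    using filter_insert[OF F(1) that(1)] max that(2) p(1) by blast
  have "x \<leadsto> y \<in> F \<or> y \<leadsto> x \<in> F" if xy: "x \<in> carrier A" "y \<in> carrier A" for x y
  proof (rule ccontr)
    let ?a = "x \<leadsto> y" and ?b = "y \<leadsto> x"
    have ab: "?a \<in> carrier A" "?b \<in> carrier A" using xy by (simp_all add: resid_closed)
    assume "\<not> (?a \<in> F \<or> ?b \<in> F)"
    then obtain f g and m n :: nat where fg: "f \<in> F" "g \<in> F" "f \<otimes> ?a [^] m \<preceq> p" "g \<otimes> ?b [^] n \<preceq> p"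
      using below ab by meson
    have c: "f \<in> carrier A" "g \<in> carrier A" using fg Fc by auto
    have "?a [^] m \<otimes> (f \<otimes> g) = f \<otimes> ?a [^] m \<otimes> g" using c ab by (simp add: m_ac)
    also have "\<dots> \<preceq> f \<otimes> ?a [^] m" using c ab by (simp add: mult_le1)
    finally have 1: "?a [^] m \<otimes> (f \<otimes> g) \<preceq> p"
      using fg(3) le_trans c ab p by (meson m_closed nat_pow_closed)
    have "?b [^] n \<otimes> (f \<otimes> g) = g \<otimes> ?b [^] n \<otimes> f" using c ab by (simp add: m_ac)
    also have "\<dots> \<preceq> g \<otimes> ?b [^] n" using c ab by (simp add: mult_le1)
    finally have 2: "?b [^] n \<otimes> (f \<otimes> g) \<preceq> p"
      using fg(4) le_trans c ab p by (meson m_closed nat_pow_closed)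
    have "?a [^] m \<curlyvee> ?b [^] n = \<one>"
      using vee_pow_eq_one[of ?b ?a m] prelinear[OF xy] ab vee_comm by (intro vee_pow_eq_one) auto
    then have "f \<otimes> g \<preceq> p" using mult_vee_le[OF 1 2] c ab p by simp
    moreover have "f \<otimes> g \<in> F" using F fg by (simp add: rl_filter_def)
    ultimately show False using F p by (auto simp: rl_filter_def)
  qed
  then have "total_filter A F"
    by (intro total_filter.intro total_filter_axioms.intro F(1) cancellative_hoop_axioms) blast
  then show ?thesis using that F(2) by blast
qed

context total_filter
begin

text \<open>The order of the quotient by \<open>F\<close>, pulled back to a preorder on the algebra
  itself.\<close>

definition fle :: "'a \<Rightarrow> 'a \<Rightarrow> bool" where
  "fle x y \<longleftrightarrow> x \<leadsto> y \<in> F"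

lemma filter_up: "\<lbrakk>x \<in> F; x \<preceq> y; y \<in> carrier A\<rbrakk> \<Longrightarrow> y \<in> F"
  using filter by (simp add: rl_filter_def)

lemma filter_mult: "\<lbrakk>x \<in> F; y \<in> F\<rbrakk> \<Longrightarrow> x \<otimes> y \<in> F"
  using filter by (simp add: rl_filter_def)

lemma fle_if_le: "\<lbrakk>x \<preceq> y; x \<in> carrier A; y \<in> carrier A\<rbrakk> \<Longrightarrow> fle x y"
  using filter by (simp add: fle_def rl_filter_def le_iff_resid)

lemma fle_total: "\<lbrakk>x \<in> carrier A; y \<in> carrier A\<rbrakk> \<Longrightarrow> fle x y \<or> fle y x"
  unfolding fle_def by (rule total)

lemma fle_trans:
  assumes "fle x y" "fle y z" "x \<in> carrier A" "y \<in> carrier A" "z \<in> carrier A"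
  shows "fle x z"
proof -
  have c: "x \<leadsto> y \<in> carrier A" "y \<leadsto> z \<in> carrier A" using assms by (simp_all add: resid_closed)
  have "(x \<leadsto> y) \<otimes> (y \<leadsto> z) \<otimes> x = x \<otimes> (x \<leadsto> y) \<otimes> (y \<leadsto> z)"
    using c assms by (simp add: m_ac)
  also have "\<dots> \<preceq> y \<otimes> (y \<leadsto> z)"
    using c assms by (intro mult_mono_left resid_mult_le) simp_all
  finally have "(x \<leadsto> y) \<otimes> (y \<leadsto> z) \<otimes> x \<preceq> z"
    using resid_mult_le[of y z] c assms le_trans by (meson m_closed)
  then have "(x \<leadsto> y) \<otimes> (y \<leadsto> z) \<preceq> x \<leadsto> z" using c assms by (simp add: residuation)
  moreover have "(x \<leadsto> y) \<otimes> (y \<leadsto> z) \<in> F"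
    using assms(1,2) filter_mult unfolding fle_def by blast
  ultimately have "x \<leadsto> z \<in> F" using filter_up assms resid_closed by blast
  then show ?thesis unfolding fle_def .
qed

lemma fle_mult_cancel:
  "\<lbrakk>x \<in> carrier A; y \<in> carrier A; z \<in> carrier A\<rbrakk> \<Longrightarrow> fle (x \<otimes> z) (y \<otimes> z) \<longleftrightarrow> fle x y"
  unfolding fle_def by (simp add: resid_mult_cancel)

lemma fle_mult_mono:
  assumes "fle x y" "fle z w" "x \<in> carrier A" "y \<in> carrier A" "z \<in> carrier A" "w \<in> carrier A"
  shows "fle (x \<otimes> z) (y \<otimes> w)"
proof (rule fle_trans)
  show "fle (x \<otimes> z) (y \<otimes> z)" using assms by (simp add: fle_mult_cancel)
  show "fle (y \<otimes> z) (y \<otimes> w)" using assms fle_mult_cancel[of z w y] by (simp add: m_comm)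
qed (use assms in simp_all)

section \<open>Exponent vectors and the cone of the preorder\<close>

definition monomial :: "'a set \<Rightarrow> ('a \<Rightarrow> nat) \<Rightarrow> 'a" where
  "monomial T p = (\<Otimes>x\<in>T. x [^] p x)"

lemma monomial_closed: "T \<subseteq> carrier A \<Longrightarrow> monomial T p \<in> carrier A"
  unfolding monomial_def by (rule finprod_closed) auto

lemma monomial_add:
  assumes "T \<subseteq> carrier A"
  shows "monomial T (\<lambda>x. p x + q x) = monomial T p \<otimes> monomial T q"
proof -
  have "monomial T (\<lambda>x. p x + q x) = (\<Otimes>x\<in>T. x [^] p x \<otimes> x [^] q x)"
    unfolding monomial_def using assms by (intro finprod_cong') (auto simp: nat_pow_mult)
  also have "\<dots> = monomial T p \<otimes> monomial T q"
    unfolding monomial_def using assms by (intro finprod_multf) auto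
  finally show ?thesis .
qed

definition unit_exponent :: "'a \<Rightarrow> 'a \<Rightarrow> nat" where
  "unit_exponent x = (\<lambda>y. if y = x then 1 else 0)"

lemma monomial_unit_exponent:
  assumes "T \<subseteq> carrier A" "finite T" "x \<in> T"
  shows "monomial T (unit_exponent x) = x"
proof -
  have "monomial T (unit_exponent x) = (\<Otimes>y\<in>T. if x = y then y else \<one>)"
    unfolding monomial_def using assms
    by (intro finprod_cong') (auto simp: unit_exponent_def)
  also have "\<dots> = x" using assms finprod_singleton[of x T "\<lambda>y. y"] by auto
  finally show ?thesis .
qed

text \<open>The exponent vectors that are nonnegative modulo \<open>F\<close>. Larger exponents give smaller elements,
  so \<open>p\<close> and \<open>q\<close> are compared in the reverse order.\<close>

definition cone :: "'a set \<Rightarrow> ('a \<Rightarrow> int) set" where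
  "cone T = {\<lambda>x. int (p x) - int (q x) | p q. fle (monomial T p) (monomial T q)}"

lemma coneI:
  "\<lbrakk>fle (monomial T p) (monomial T q); u = (\<lambda>x. int (p x) - int (q x))\<rbrakk> \<Longrightarrow> u \<in> cone T"
  unfolding cone_def by blast

lemma cone_plus_closed:
  assumes "T \<subseteq> carrier A"
  shows "plus_closed (cone T)"
  unfolding plus_closed_def
proof (intro ballI)
  fix u w assume "u \<in> cone T" "w \<in> cone T"
  then obtain p q p' q' where u: "u = (\<lambda>x. int (p x) - int (q x))" "fle (monomial T p) (monomial T q)"
    and w: "w = (\<lambda>x. int (p' x) - int (q' x))" "fle (monomial T p') (monomial T q')"
    unfolding cone_def by auto
  have "fle (monomial T (\<lambda>x. p x + p' x)) (monomial T (\<lambda>x. q x + q' x))"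
    using u w assms by (simp add: monomial_add fle_mult_mono monomial_closed)
  moreover have "(\<lambda>x. u x + w x) = (\<lambda>x. int (p x + p' x) - int (q x + q' x))"
    by (simp add: u w algebra_simps)
  ultimately show "(\<lambda>x. u x + w x) \<in> cone T" by (rule coneI)
qed

text \<open>The positive and negative parts of \<open>u\<close> give two monomials, and any two
  elements are comparable modulo \<open>F\<close>.\<close>

lemma cone_total:
  assumes "T \<subseteq> carrier A"
  shows "u \<in> cone T \<or> (\<lambda>x. - u x) \<in> cone T"
proof -
  let ?p = "\<lambda>x. nat (u x)" and ?q = "\<lambda>x. nat (- u x)"
  have "u = (\<lambda>x. int (?p x) - int (?q x))" "(\<lambda>x. - u x) = (\<lambda>x. int (?q x) - int (?p x))" by auto
  moreover have "fle (monomial T ?p) (monomial T ?q) \<or> fle (monomial T ?q) (monomial T ?p)"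
    using assms by (intro fle_total monomial_closed)
  ultimately show ?thesis using coneI by meson
qed

text \<open>Membership in the cone does not depend on how a vector is written as a difference: from
  \<open>p - q = p' - q'\<close> follows \<open>p + q' = q + p'\<close>, and the monomial of
  \<open>q'\<close> can be cancelled modulo \<open>F\<close>.\<close>

lemma fle_if_cone:
  assumes T: "T \<subseteq> carrier A" and "(\<lambda>x. int (p x) - int (q x)) \<in> cone T"
  shows "fle (monomial T p) (monomial T q)"
proof -
  obtain p' q' where eq: "(\<lambda>x. int (p x) - int (q x)) = (\<lambda>x. int (p' x) - int (q' x))"
    and le: "fle (monomial T p') (monomial T q')"
    using assms(2) unfolding cone_def by auto
  have "p x + q' x = q x + p' x" for x using fun_cong[OF eq, of x] by linarith
  then have "monomial T p \<otimes> monomial T q' = monomial T q \<otimes> monomial T p'"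
    using T by (simp flip: monomial_add)
  moreover have "fle (monomial T q \<otimes> monomial T p') (monomial T q \<otimes> monomial T q')"
    using T le by (intro fle_mult_mono[OF _ le] fle_if_le le_refl monomial_closed)
  ultimately have "fle (monomial T p \<otimes> monomial T q') (monomial T q \<otimes> monomial T q')" by simp
  then show ?thesis using T by (simp add: fle_mult_cancel monomial_closed)
qed

text \<open>Each valid comparison of two-factor products over \<open>T\<close> becomes a vector in
  the cone, and the failing comparison of \<open>a\<close> with \<open>b\<close> a vector outside
  it. An integer solution of these finitely many inequalities assigns exponents, reversing the
  order.\<close>

lemma ex_exponent_map:
  assumes T: "finite T" "T \<subseteq> carrier A" "\<one> \<in> T" and ab: "a \<in> T" "b \<in> T" "\<not> fle a b"
  obtains \<phi> :: "'a \<Rightarrow> int" where "\<phi> \<one> = 0" "\<phi> a < \<phi> b"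
    "\<And>x y z w. \<lbrakk>x \<in> T; y \<in> T; z \<in> T; w \<in> T; fle (x \<otimes> y) (z \<otimes> w)\<rbrakk> \<Longrightarrow> \<phi> z + \<phi> w \<le> \<phi> x + \<phi> y"
proof -
  define e where "e = unit_exponent"
  \<comment> \<open>The exponents of \<open>x \<otimes> y\<close> minus those of
    \<open>z \<otimes> w\<close>. Nonnegativity of the corresponding sum reads
    \<open>\<psi> z + \<psi> w \<le> \<psi> x + \<psi> y\<close>.\<close>
  define vec where "vec = (\<lambda>(x, y, z, w) t. int (e x t + e y t) - int (e z t + e w t))"
  define W where "W = vec ` {(x, y, z, w) \<in> T \<times> T \<times> T \<times> T. fle (x \<otimes> y) (z \<otimes> w)}"
  define u0 where "u0 = (\<lambda>t. int (e a t) - int (e b t))"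
  have mono: "monomial T (e x) = x" if "x \<in> T" for x
    unfolding e_def using T(2,1) that by (rule monomial_unit_exponent)
  have mono2: "monomial T (\<lambda>t. e x t + e y t) = x \<otimes> y" if "x \<in> T" "y \<in> T" for x y
    using that T by (simp add: monomial_add mono)
  have out: "e x t = 0" if "x \<in> T" "t \<notin> T" for x t
    using that by (auto simp: e_def unit_exponent_def)
  have W: "W \<subseteq> cone T" "finite W"
  proof
    fix u assume "u \<in> W"
    then obtain x y z w where xyzw: "x \<in> T" "y \<in> T" "z \<in> T" "w \<in> T" "fle (x \<otimes> y) (z \<otimes> w)"
      and u: "u = vec (x, y, z, w)" by (auto simp: W_def)
    have "fle (monomial T (\<lambda>t. e x t + e y t)) (monomial T (\<lambda>t. e z t + e w t))"
      using xyzw by (simp add: mono2)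
    then show "u \<in> cone T" by (rule coneI) (simp add: u vec_def)
  next
    have "finite {(x, y, z, w) \<in> T \<times> T \<times> T \<times> T. fle (x \<otimes> y) (z \<otimes> w)}"
      using T(1) by (rule_tac finite_subset[of _ "T \<times> T \<times> T \<times> T"]) auto
    then show "finite W" unfolding W_def by (rule finite_imageI)
  qed
  have Wout: "u x = 0" if "u \<in> W" "x \<notin> T" for u x
    using that by (auto simp: W_def vec_def out)
  have "u0 \<notin> cone T"
  proof
    assume "u0 \<in> cone T"
    then have "fle (monomial T (e a)) (monomial T (e b))"
      unfolding u0_def by (rule fle_if_cone[OF T(2)])
    then show False using ab by (simp add: mono)
  qed
  moreover have "u0 x = 0" if "x \<notin> T" for x using that ab by (simp add: u0_def out)
  ultimately obtain \<psi> :: "'a \<Rightarrow> int" where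
    \<psi>: "\<And>u. u \<in> W \<Longrightarrow> 0 \<le> (\<Sum>x\<in>T. u x * \<psi> x)" and less: "(\<Sum>x\<in>T. u0 x * \<psi> x) < 0"
    using linear_system_solvable_int[of "cone T" T W u0] cone_plus_closed[OF T(2)]
      cone_total[OF T(2)] T(1) W Wout by blast
  have sum: "(\<Sum>t\<in>T. int (e x t) * \<psi> t) = \<psi> x" if "x \<in> T" for x
  proof -
    have "(\<Sum>t\<in>T. int (e x t) * \<psi> t) = (\<Sum>t\<in>T. if t = x then \<psi> t else 0)"
      by (rule sum.cong) (auto simp: e_def unit_exponent_def)
    then show ?thesis using that T(1) by simp
  qed
  show ?thesis
  \<comment> \<open>The shift makes the value at \<open>\<one>\<close> zero. It keeps all
    inequalities, since both sides have equally many summands.\<close>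
  proof (rule that[of "\<lambda>x. \<psi> x - \<psi> \<one>"])
    have "\<psi> a - \<psi> b < 0"
      using less ab by (simp add: u0_def left_diff_distrib sum_subtractf sum)
    then show "\<psi> a - \<psi> \<one> < \<psi> b - \<psi> \<one>" by simp
    fix x y z w assume xyzw: "x \<in> T" "y \<in> T" "z \<in> T" "w \<in> T" "fle (x \<otimes> y) (z \<otimes> w)"
    then have "vec (x, y, z, w) \<in> W" unfolding W_def by blast
    then have "0 \<le> \<psi> x + \<psi> y - (\<psi> z + \<psi> w)"
      using \<psi>[of "vec (x, y, z, w)"] xyzw
      by (simp add: vec_def left_diff_distrib distrib_right sum_subtractf sum.distrib sum)
    then show "\<psi> z - \<psi> \<one> + (\<psi> w - \<psi> \<one>) \<le> \<psi> x - \<psi> \<one> + (\<psi> y - \<psi> \<one>)" by simp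
  qed simp
qed

text \<open>Modulo \<open>F\<close>, the result of each operation is determined by comparisons
  between products of at most two elements, which \<open>ex_exponent_map\<close> transfers to
  integers.\<close>

lemma ex_separating_map:
  assumes S: "finite S" "S \<subseteq> carrier A" and ab: "a \<in> carrier A" "b \<in> carrier A" "\<not> fle a b"
  obtains \<phi> :: "'a \<Rightarrow> nat" where "\<phi> \<one> = 0" "\<phi> a < \<phi> b"
    "\<And>x y. \<lbrakk>x \<in> S; y \<in> S\<rbrakk> \<Longrightarrow> \<phi> (x \<otimes> y) = \<phi> x + \<phi> y \<and> \<phi> (x \<curlyvee> y) = min (\<phi> x) (\<phi> y) \<and>
        \<phi> (x \<curlywedge> y) = max (\<phi> x) (\<phi> y) \<and> \<phi> (x \<leadsto> y) = \<phi> y - \<phi> x"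
proof -
  \<comment> \<open>The results of single operations on \<open>S\<close> are included, so that the
    exponent map is controlled at them too.\<close>
  define T where "T = {\<one>, a, b} \<union> S \<union> (\<Union>x\<in>S. \<Union>y\<in>S. {x \<otimes> y, x \<curlyvee> y, x \<curlywedge> y, x \<leadsto> y})"
  have T: "finite T" "T \<subseteq> carrier A" "\<one> \<in> T" "a \<in> T" "b \<in> T" "S \<subseteq> T"
    using S ab by (auto simp: T_def subset_iff vee_closed wedge_closed resid_closed)
  obtain \<psi> :: "'a \<Rightarrow> int" where one: "\<psi> \<one> = 0" and less: "\<psi> a < \<psi> b" and le2:
    "\<And>x y z w. \<lbrakk>x \<in> T; y \<in> T; z \<in> T; w \<in> T; fle (x \<otimes> y) (z \<otimes> w)\<rbrakk> \<Longrightarrow> \<psi> z + \<psi> w \<le> \<psi> x + \<psi> y"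
    using ex_exponent_map[OF T(1-5) ab(3)] by blast
  have le: "\<psi> y \<le> \<psi> x" if "x \<in> T" "y \<in> T" "fle x y" for x y
    using le2[of x \<one> y \<one>] that T one by (auto simp: subsetD)
  have eq: "\<psi> y = \<psi> x" if "x \<in> T" "y \<in> T" "fle x y" "fle y x" for x y
    using le[of x y] le[of y x] that by simp
  have nonneg: "0 \<le> \<psi> x" if "x \<in> T" for x
    using le[of x \<one>] that T one by (simp add: fle_if_le integral subsetD)
  have mult: "\<psi> (x \<otimes> y) = \<psi> x + \<psi> y" if "x \<in> S" "y \<in> S" for x y
  proof -
    have xy: "x \<in> T" "y \<in> T" "x \<otimes> y \<in> T" "x \<otimes> y \<in> carrier A" using that T by (auto simp: T_def)
    then have "fle (x \<otimes> y) (x \<otimes> y)" by (simp add: fle_if_le le_refl)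
    \<comment> \<open>\<open>x \<otimes> y\<close> is compared with itself in both directions,
      padded by the factor \<open>\<one>\<close> of exponent 0.\<close>
    then show ?thesis using le2[of "x \<otimes> y" \<one> x y] le2[of x y "x \<otimes> y" \<one>] xy T one by simp
  qed
  \<comment> \<open>For \<open>fle x y\<close>, modulo \<open>F\<close> the meet is
    \<open>x\<close>, the join is \<open>y\<close>, the residual \<open>x \<leadsto> y\<close> is
    \<open>\<one>\<close>, and \<open>y \<leadsto> x\<close> is the quotient of \<open>x\<close> by
    \<open>y\<close>. Totality reduces the general case to this one.\<close>
  have ops: "\<psi> (x \<curlyvee> y) = min (\<psi> x) (\<psi> y) \<and> \<psi> (x \<curlywedge> y) = max (\<psi> x) (\<psi> y) \<and>
      \<psi> (x \<leadsto> y) = 0 \<and> \<psi> (y \<leadsto> x) = \<psi> x - \<psi> y \<and> \<psi> y \<le> \<psi> x"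
    if xy: "x \<in> S" "y \<in> S" and fle: "fle x y" for x y
  proof -
    have t: "x \<in> T" "y \<in> T" "x \<curlyvee> y \<in> T" "x \<curlywedge> y \<in> T" "x \<leadsto> y \<in> T" "y \<leadsto> x \<in> T"
      using xy by (auto simp: T_def)
    then have c: "x \<in> carrier A" "y \<in> carrier A" "x \<curlyvee> y \<in> carrier A" "x \<curlywedge> y \<in> carrier A"
      "x \<leadsto> y \<in> carrier A" "y \<leadsto> x \<in> carrier A" using T by auto
    have r: "fle \<one> (x \<leadsto> y)"
      using fle c by (simp add: fle_def one_resid)
    have x: "fle x (x \<curlywedge> y)"
      using fle_mult_mono[OF _ r, of x x] c by (simp add: wedge_eq fle_if_le le_refl)
    have y: "fle (x \<curlyvee> y) y"
    proof -
      have "(x \<leadsto> y) \<otimes> x \<preceq> y" using resid_mult_le[of x y] c by (simp add: m_comm)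
      then have "x \<otimes> (x \<leadsto> y) \<preceq> y" "y \<otimes> (x \<leadsto> y) \<preceq> y" using c by (simp_all add: m_comm mult_le1 mult_le2)
      from mult_vee_le[OF this] have "(x \<leadsto> y) \<otimes> (x \<curlyvee> y) \<preceq> y" using c by (simp add: m_comm)
      then have "x \<leadsto> y \<preceq> x \<curlyvee> y \<leadsto> y" using c by (simp add: residuation)
      then show ?thesis using fle c unfolding fle_def by (blast intro: filter_up resid_closed)
    qed
    have q: "fle (y \<otimes> (y \<leadsto> x)) (x \<otimes> \<one>)"
      using resid_mult_le[of y x] c by (simp add: fle_if_le)
    have q': "fle (x \<otimes> \<one>) (y \<otimes> (y \<leadsto> x))"
      using x c by (simp add: wedge_eq flip: hoop[of x y])
    have "\<psi> (x \<curlywedge> y) = \<psi> x" using eq[OF t(1,4) x] c by (simp add: fle_if_le wedge_lower1)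
    moreover have "\<psi> (x \<curlyvee> y) = \<psi> y" using eq[OF t(3,2) y] c by (simp add: fle_if_le vee_upper2)
    moreover have "\<psi> (x \<leadsto> y) = 0" using eq[OF T(3) t(5) r] c one by (simp add: fle_if_le integral)
    moreover have "\<psi> y + \<psi> (y \<leadsto> x) = \<psi> x"
      using le2[OF _ _ _ _ q] le2[OF _ _ _ _ q'] t T one by simp
    ultimately show ?thesis using le[OF t(1,2) fle] by auto
  qed
  show ?thesis
  \<comment> \<open>On \<open>T\<close> the values are nonnegative, because every element lies below
    \<open>\<one>\<close> and \<open>\<psi>\<close> reverses the order.\<close>
  proof (rule that[of "nat \<circ> \<psi>"])
    show "(nat \<circ> \<psi>) \<one> = 0" using one by simp
    show "(nat \<circ> \<psi>) a < (nat \<circ> \<psi>) b" using less nonneg[OF T(4)] by simp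
    fix x y assume xy: "x \<in> S" "y \<in> S"
    then have c: "x \<in> carrier A" "y \<in> carrier A" and nn: "0 \<le> \<psi> x" "0 \<le> \<psi> y"
      using S nonneg T by auto
    consider "fle x y" | "fle y x" using fle_total c by blast
    then show "(nat \<circ> \<psi>) (x \<otimes> y) = (nat \<circ> \<psi>) x + (nat \<circ> \<psi>) y \<and>
        (nat \<circ> \<psi>) (x \<curlyvee> y) = min ((nat \<circ> \<psi>) x) ((nat \<circ> \<psi>) y) \<and>
        (nat \<circ> \<psi>) (x \<curlywedge> y) = max ((nat \<circ> \<psi>) x) ((nat \<circ> \<psi>) y) \<and>
        (nat \<circ> \<psi>) (x \<leadsto> y) = (nat \<circ> \<psi>) y - (nat \<circ> \<psi>) x"
    proof cases
      case 1
      then show ?thesis using ops[OF xy 1] mult[OF xy] nn by auto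
    next
      case 2
      then show ?thesis using ops[OF xy(2,1) 2] mult[OF xy] nn vee_comm[OF c] wedge_comm[OF c] by auto
    qed
  qed
qed

end

text \<open>By antisymmetry one of \<open>a \<preceq> b\<close> and \<open>b \<preceq> a\<close>
  fails, so the residual in that direction is not \<open>\<one>\<close> and is omitted by some total
  filter.\<close>

lemma (in cancellative_hoop) ex_local_hom_C_omega:
  assumes S: "finite S" "S \<subseteq> carrier A" and ab: "a \<in> carrier A" "b \<in> carrier A" "a \<noteq> b"
  shows "\<exists>\<phi> :: 'a \<Rightarrow> nat. \<phi> a \<noteq> \<phi> b \<and> \<phi> \<one> = 0 \<and>
    (\<forall>x\<in>S. \<forall>y\<in>S. \<phi> (x \<otimes> y) = \<phi> x + \<phi> y \<and> \<phi> (x \<curlyvee> y) = min (\<phi> x) (\<phi> y) \<and>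
        \<phi> (x \<curlywedge> y) = max (\<phi> x) (\<phi> y) \<and> \<phi> (x \<leadsto> y) = \<phi> y - \<phi> x)"
    (is "\<exists>\<phi>. _ \<and> ?hom \<phi>")
proof -
  have *: "\<exists>\<phi>. \<phi> x < \<phi> y \<and> ?hom \<phi>" if xy: "x \<in> carrier A" "y \<in> carrier A" "\<not> x \<preceq> y" for x y
  proof -
    have "x \<leadsto> y \<in> carrier A" "x \<leadsto> y \<noteq> \<one>" using xy by (auto simp: resid_closed le_iff_resid)
    then obtain F where "total_filter A F" and F: "x \<leadsto> y \<notin> F" using ex_total_filter by blast
    then interpret total_filter A F by simp
    have "\<not> fle x y" using F by (simp add: fle_def)
    then show ?thesis by (rule ex_separating_map[OF S xy(1,2)]) blast
  qed
  have "\<not> a \<preceq> b \<or> \<not> b \<preceq> a" using ab le_antisym by blast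
  then show ?thesis
  proof
    assume "\<not> a \<preceq> b"
    from *[OF ab(1,2) this] obtain \<phi> :: "'a \<Rightarrow> nat" where "\<phi> a < \<phi> b" "?hom \<phi>" by blast
    then show ?thesis by (intro exI[of _ \<phi>]) simp
  next
    assume "\<not> b \<preceq> a"
    from *[OF ab(2,1) this] obtain \<phi> :: "'a \<Rightarrow> nat" where "\<phi> b < \<phi> a" "?hom \<phi>" by blast
    then show ?thesis by (intro exI[of _ \<phi>]) simp
  qed
qed

section \<open>Identities of K\<close>

lemma eval_term_closed:
  assumes "rl_algebra A" "range v \<subseteq> carrier A"
  shows "eval_term A v t \<in> carrier A"
  using assms by (induction t) (auto simp: rl_algebra_def)

lemma eval_term_hom:
  assumes "h \<in> rl_hom A B" "rl_algebra A" "range v \<subseteq> carrier A"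
  shows "h (eval_term A v t) = eval_term B (h \<circ> v) t"
  using assms(1) eval_term_closed[OF assms(2,3)]
  by (induction t) (auto simp: rl_hom_def)

lemma satisfies_embeds_in:
  assumes "embeds_in A B" "rl_algebra A" "satisfies B e"
  shows "satisfies A e"
  unfolding satisfies_def
proof (intro allI impI)
  fix v :: "nat \<Rightarrow> 'a" assume v: "range v \<subseteq> carrier A"
  obtain h where h: "h \<in> rl_hom A B" "inj_on h (carrier A)" using assms(1) by (auto simp: embeds_in_def)
  have "range (h \<circ> v) \<subseteq> carrier B" using h(1) v by (auto simp: rl_hom_def)
  then have "h (eval_term A v (fst e)) = h (eval_term A v (snd e))"
    using assms(3) eval_term_hom[OF h(1) assms(2) v] by (simp add: satisfies_def)
  then show "eval_term A v (fst e) = eval_term A v (snd e)"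
    using h(2) eval_term_closed[OF assms(2) v] by (simp add: inj_on_def)
qed

text \<open>The identities of \<open>B\<close> form the largest set that \<open>B\<close> models,
  hence define the smallest class of models.\<close>

lemma generated_variety_eq:
  assumes "rl_algebra B"
  shows "(generated_variety B :: 'b rl set) = models {e. satisfies B e}"
  unfolding generated_variety_def
proof (intro antisym Inter_lower Inter_greatest)
  show "models {e. satisfies B e} \<in> {models E | E. B \<in> models E}"
    using assms by (intro CollectI exI[of _ "{e. satisfies B e}"] conjI refl) (simp add: models_def)
  fix X :: "'b rl set" assume "X \<in> {models E | E. B \<in> models E}"
  then show "models {e. satisfies B e} \<subseteq> X" by (auto simp: models_def)
qed

lemma K_simps:
  "carrier (K A) = carrier A \<times> carrier A"
  "\<one>\<^bsub>K A\<^esub> = (\<one>\<^bsub>A\<^esub>, \<one>\<^bsub>A\<^esub>)"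
  "(a, b) \<otimes>\<^bsub>K A\<^esub> (c, d) = (a \<otimes>\<^bsub>A\<^esub> c, (a \<leadsto>\<^bsub>A\<^esub> d) \<curlywedge>\<^bsub>A\<^esub> (c \<leadsto>\<^bsub>A\<^esub> b))"
  "(a, b) \<curlyvee>\<^bsub>K A\<^esub> (c, d) = (a \<curlyvee>\<^bsub>A\<^esub> c, b \<curlywedge>\<^bsub>A\<^esub> d)"
  "(a, b) \<curlywedge>\<^bsub>K A\<^esub> (c, d) = (a \<curlywedge>\<^bsub>A\<^esub> c, b \<curlyvee>\<^bsub>A\<^esub> d)"
  "(a, b) \<leadsto>\<^bsub>K A\<^esub> (c, d) = ((a \<leadsto>\<^bsub>A\<^esub> c) \<curlywedge>\<^bsub>A\<^esub> (d \<leadsto>\<^bsub>A\<^esub> b), a \<otimes>\<^bsub>A\<^esub> d)"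
  by (simp_all add: K_def)

lemma C_omega_simps:
  "carrier C_omega = UNIV" "\<one>\<^bsub>C_omega\<^esub> = 0" "r \<otimes>\<^bsub>C_omega\<^esub> s = r + s" "r \<curlyvee>\<^bsub>C_omega\<^esub> s = min r s"
  "r \<curlywedge>\<^bsub>C_omega\<^esub> s = max r s" "r \<leadsto>\<^bsub>C_omega\<^esub> s = s - r"
  by (simp_all add: C_omega_def)

lemma rl_algebra_C_omega: "rl_algebra C_omega"
  by (simp add: rl_algebra_def C_omega_simps)

lemma rl_algebra_K: "rl_algebra A \<Longrightarrow> rl_algebra (K A)"
  by (auto simp: rl_algebra_def K_simps)

lemma map_prod_rl_hom_K:
  assumes "h \<in> rl_hom A B" "rl_algebra A"
  shows "map_prod h h \<in> rl_hom (K A) (K B)"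
  using assms by (auto simp: rl_hom_def rl_algebra_def K_simps)

section \<open>Transfer of identities along local homomorphisms\<close>

primrec subterm_values :: "'a rl \<Rightarrow> (nat \<Rightarrow> 'a) \<Rightarrow> rl_term \<Rightarrow> 'a set" where
  "subterm_values A v (Var n) = {v n}"
| "subterm_values A v One = {\<one>\<^bsub>A\<^esub>}"
| "subterm_values A v (Vee s t) =
    {eval_term A v (Vee s t)} \<union> subterm_values A v s \<union> subterm_values A v t"
| "subterm_values A v (Wedge s t) =
    {eval_term A v (Wedge s t)} \<union> subterm_values A v s \<union> subterm_values A v t"
| "subterm_values A v (Mult s t) =
    {eval_term A v (Mult s t)} \<union> subterm_values A v s \<union> subterm_values A v t"
| "subterm_values A v (Resid s t) =
    {eval_term A v (Resid s t)} \<union> subterm_values A v s \<union> subterm_values A v t"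

lemma eval_term_in_subterm_values: "eval_term A v t \<in> subterm_values A v t"
  by (cases t) auto

lemma finite_subterm_values: "finite (subterm_values A v t)"
  by (induction t) auto

lemma subterm_values_closed:
  assumes "rl_algebra A" "range v \<subseteq> carrier A"
  shows "subterm_values A v t \<subseteq> carrier A"
  using eval_term_closed[OF assms]
proof (induction t)
  case (Var n)
  then show ?case using assms by auto
next
  case One
  then show ?case using assms by (auto simp: rl_algebra_def)
qed (auto simp del: eval_term.simps)

text \<open>Product and residual of \<open>K L\<close> contain meets of two residuals of
  \<open>L\<close>. Hence \<open>\<phi>\<close> has to respect the operations on the residuals of
  elements of \<open>U\<close> as well, which is what \<open>S\<close> adds.\<close>

lemma eval_term_K_local_hom:
  fixes \<phi> :: "'a \<Rightarrow> nat"
  assumes "subterm_values (K L) v t \<subseteq> U \<times> U" "\<phi> \<one>\<^bsub>L\<^esub> = 0"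
    and "S = U \<union> (\<Union>x\<in>U. \<Union>y\<in>U. {x \<leadsto>\<^bsub>L\<^esub> y})"
    and "\<forall>x\<in>S. \<forall>y\<in>S. \<phi> (x \<otimes>\<^bsub>L\<^esub> y) = \<phi> x + \<phi> y \<and> \<phi> (x \<curlyvee>\<^bsub>L\<^esub> y) = min (\<phi> x) (\<phi> y) \<and>
        \<phi> (x \<curlywedge>\<^bsub>L\<^esub> y) = max (\<phi> x) (\<phi> y) \<and> \<phi> (x \<leadsto>\<^bsub>L\<^esub> y) = \<phi> y - \<phi> x"
  shows "map_prod \<phi> \<phi> (eval_term (K L) v t) = eval_term (K C_omega) (map_prod \<phi> \<phi> \<circ> v) t"
proof -
  have binary: "map_prod \<phi> \<phi> (p \<otimes>\<^bsub>K L\<^esub> q) = map_prod \<phi> \<phi> p \<otimes>\<^bsub>K C_omega\<^esub> map_prod \<phi> \<phi> q \<and>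
      map_prod \<phi> \<phi> (p \<curlyvee>\<^bsub>K L\<^esub> q) = map_prod \<phi> \<phi> p \<curlyvee>\<^bsub>K C_omega\<^esub> map_prod \<phi> \<phi> q \<and>
      map_prod \<phi> \<phi> (p \<curlywedge>\<^bsub>K L\<^esub> q) = map_prod \<phi> \<phi> p \<curlywedge>\<^bsub>K C_omega\<^esub> map_prod \<phi> \<phi> q \<and>
      map_prod \<phi> \<phi> (p \<leadsto>\<^bsub>K L\<^esub> q) = map_prod \<phi> \<phi> p \<leadsto>\<^bsub>K C_omega\<^esub> map_prod \<phi> \<phi> q"
    if pq: "p \<in> U \<times> U" "q \<in> U \<times> U" for p q
  proof -
    obtain a b c d where eq: "p = (a, b)" "q = (c, d)" by (metis surj_pair)
    then have "{a, b, c, d, a \<leadsto>\<^bsub>L\<^esub> d, c \<leadsto>\<^bsub>L\<^esub> b, a \<leadsto>\<^bsub>L\<^esub> c, d \<leadsto>\<^bsub>L\<^esub> b} \<subseteq> S"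
      using pq by (auto simp: assms(3))
    then show ?thesis using assms(4) by (simp add: eq K_simps C_omega_simps)
  qed
  have inside: "eval_term (K L) v t \<in> U \<times> U" if "subterm_values (K L) v t \<subseteq> U \<times> U" for t
    using that eval_term_in_subterm_values by blast
  show ?thesis using assms(1)
  proof (induction t)
    case One
    then show ?case by (simp add: K_simps C_omega_simps assms(2))
  next
    case (Vee s t)
    then show ?case
      using binary[OF inside[of s] inside[of t]] by simp
  next
    case (Wedge s t)
    then show ?case
      using binary[OF inside[of s] inside[of t]] by simp
  next
    case (Mult s t)
    then show ?case
      using binary[OF inside[of s] inside[of t]] by simp
  next
    case (Resid s t)
    then show ?case
      using binary[OF inside[of s] inside[of t]] by simp
  qed simp
qed

text \<open>A refuting assignment in \<open>K L\<close> involves only the finitely many coordinates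
  of subterm values. A local homomorphism that separates the two sides in one coordinate turns it
  into a refutation in \<open>K C_omega\<close>.\<close>

lemma satisfies_K_cancellative_hoop:
  assumes "cancellative_hoop L" "satisfies (K C_omega) e"
  shows "satisfies (K L) e"
proof (rule ccontr)
  interpret cancellative_hoop L by fact
  let ?ev = "eval_term (K L)"
  assume "\<not> satisfies (K L) e"
  then obtain v where v: "range v \<subseteq> carrier (K L)" and ne: "?ev v (fst e) \<noteq> ?ev v (snd e)"
    by (auto simp: satisfies_def)
  have alg: "rl_algebra (K L)" by (rule rl_algebra_K[OF rl_algebra])
  define V where "V = subterm_values (K L) v (fst e) \<union> subterm_values (K L) v (snd e)"
  have V: "finite V" "V \<subseteq> carrier L \<times> carrier L"
    using subterm_values_closed[OF alg v] by (auto simp: V_def finite_subterm_values K_simps)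
  define U where "U = fst ` V \<union> snd ` V"
  define S where "S = U \<union> (\<Union>x\<in>U. \<Union>y\<in>U. {x \<leadsto>\<^bsub>L\<^esub> y})"
  have U: "finite U" "U \<subseteq> carrier L" "V \<subseteq> U \<times> U" using V by (force simp: U_def)+
  then have S: "finite S" "S \<subseteq> carrier L" by (auto simp: S_def subset_iff resid_closed)
  have closed: "?ev v t \<in> carrier L \<times> carrier L" for t
    using eval_term_closed[OF alg v] by (simp add: K_simps)
  \<comment> \<open>The two sides differ in some coordinate; \<open>a\<close> and \<open>b\<close>
    are their values there.\<close>
  then obtain a b where ab: "a \<in> carrier L" "b \<in> carrier L" "a \<noteq> b"
    and proj: "(a, b) = (fst (?ev v (fst e)), fst (?ev v (snd e))) \<or>
      (a, b) = (snd (?ev v (fst e)), snd (?ev v (snd e)))"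
    using ne by (metis mem_Times_iff prod_eqI)
  obtain \<phi> :: "'a \<Rightarrow> nat" where \<phi>: "\<phi> a \<noteq> \<phi> b" "\<phi> \<one>\<^bsub>L\<^esub> = 0" and
    hom: "\<forall>x\<in>S. \<forall>y\<in>S. \<phi> (x \<otimes>\<^bsub>L\<^esub> y) = \<phi> x + \<phi> y \<and> \<phi> (x \<curlyvee>\<^bsub>L\<^esub> y) = min (\<phi> x) (\<phi> y) \<and>
        \<phi> (x \<curlywedge>\<^bsub>L\<^esub> y) = max (\<phi> x) (\<phi> y) \<and> \<phi> (x \<leadsto>\<^bsub>L\<^esub> y) = \<phi> y - \<phi> x"
    using ex_local_hom_C_omega[OF S ab] by blast
  have "map_prod \<phi> \<phi> (?ev v t) = eval_term (K C_omega) (map_prod \<phi> \<phi> \<circ> v) t"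
    if "t \<in> {fst e, snd e}" for t
    using that U(3) by (intro eval_term_K_local_hom[OF _ \<phi>(2) S_def hom]) (auto simp: V_def)
  moreover have "eval_term (K C_omega) (map_prod \<phi> \<phi> \<circ> v) (fst e)
      = eval_term (K C_omega) (map_prod \<phi> \<phi> \<circ> v) (snd e)"
    using assms(2) by (simp add: satisfies_def K_simps C_omega_simps)
  ultimately have "map_prod \<phi> \<phi> (?ev v (fst e)) = map_prod \<phi> \<phi> (?ev v (snd e))" by simp
  then have "\<phi> a = \<phi> b" using proj by (metis Pair_inject fst_map_prod snd_map_prod)
  then show False using \<phi>(1) by simp
qed

lemma K_class_cancellative_hoops_subset:
  "K_class (cancellative_hoops :: 'b rl set) \<subseteq> (generated_variety (K C_omega) :: 'a rl set)"
proof
  fix A :: "'a rl" assume "A \<in> K_class (cancellative_hoops :: 'b rl set)"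
  then obtain L :: "'b rl" where A: "K_lattice A" and L: "cancellative_hoop L" "embeds_in A (K L)"
    by (auto simp: K_class_def KL_def mem_cancellative_hoops)
  have alg: "rl_algebra A"
    using A by (intro comm_residuated_lattice.rl_algebra) (simp add: K_lattice_def)
  show "A \<in> generated_variety (K C_omega)"
    unfolding generated_variety_eq[OF rl_algebra_K[OF rl_algebra_C_omega]]
    using alg satisfies_embeds_in[OF L(2) alg satisfies_K_cancellative_hoop[OF L(1)]]
    by (simp add: models_def)
qed

section \<open>Computing in \<open>K C_omega\<close> and transferring its identities\<close>

lemma K_C_omega_ops:
  "carrier (K C_omega) = UNIV"
  "\<one>\<^bsub>K C_omega\<^esub> = (0, 0)"
  "p \<otimes>\<^bsub>K C_omega\<^esub> q = (fst p + fst q, max (snd q - fst p) (snd p - fst q))"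
  "p \<curlyvee>\<^bsub>K C_omega\<^esub> q = (min (fst p) (fst q), max (snd p) (snd q))"
  "p \<curlywedge>\<^bsub>K C_omega\<^esub> q = (max (fst p) (fst q), min (snd p) (snd q))"
  "p \<leadsto>\<^bsub>K C_omega\<^esub> q = (max (fst q - fst p) (snd p - snd q), fst p + snd q)"
  by (simp_all add: K_def C_omega_simps case_prod_unfold)

text \<open>The identities below have at most three variables; all remaining variables receive the
  value \<open>z\<close>.\<close>

definition assign :: "'a \<Rightarrow> 'a \<Rightarrow> 'a \<Rightarrow> nat \<Rightarrow> 'a" where
  "assign x y z = (\<lambda>n. if n = 0 then x else if n = 1 then y else z)"

lemma assign_simps [simp]:
  "assign x y z 0 = x" "assign x y z 1 = y" "assign x y z (Suc 0) = y" "assign x y z 2 = z"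
  by (simp_all add: assign_def)

lemma nat_diff_distribs:
  fixes a b c :: nat
  shows "max a b - c = max (a - c) (b - c)" "min a b - c = min (a - c) (b - c)"
    "a - max b c = min (a - b) (a - c)" "a - min b c = max (a - b) (a - c)"
  by auto

abbreviation (input) "X \<equiv> Var 0"
abbreviation (input) "Y \<equiv> Var 1"
abbreviation (input) "Z \<equiv> Var 2"
abbreviation (input) "Cut t \<equiv> Wedge t One"
abbreviation (input) "Neg t \<equiv> Resid t One"

locale K_C_omega_model =
  fixes A :: "'a rl" (structure)
  assumes algebra: "rl_algebra A"
    and identities: "satisfies (K C_omega) e \<Longrightarrow> satisfies A e"

lemma mem_generated_variety_K_C_omega:
  "A \<in> generated_variety (K C_omega) \<longleftrightarrow> K_C_omega_model A"
  unfolding generated_variety_eq[OF rl_algebra_K[OF rl_algebra_C_omega]]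
  by (auto simp: models_def K_C_omega_model_def)

context K_C_omega_model
begin

lemma identity:
  assumes "\<And>v. eval_term (K C_omega) v s = eval_term (K C_omega) v t"
    and "x \<in> carrier A" "y \<in> carrier A" "z \<in> carrier A"
  shows "eval_term A (assign x y z) s = eval_term A (assign x y z) t"
proof -
  have "satisfies A (s, t)" using assms(1) by (intro identities) (simp add: satisfies_def)
  moreover have "range (assign x y z) \<subseteq> carrier A" using assms by (auto simp: assign_def)
  ultimately show ?thesis by (simp add: satisfies_def)
qed

text \<open>Elimination form of \<open>identity\<close>. Given two terms, it leaves an equation of
  truncated arithmetic on exponents to be checked, and the reading of both terms in
  \<open>A\<close>.\<close>

lemma law:
  assumes "\<And>v. eval_term (K C_omega) v s = eval_term (K C_omega) v t"
    and "x \<in> carrier A" "y \<in> carrier A" "z \<in> carrier A"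
    and "eval_term A (assign x y z) s = eval_term A (assign x y z) t \<Longrightarrow> P"
  shows P
  using assms(5) identity[OF assms(1-4)] by blast

lemma closed:
  "\<one> \<in> carrier A"
  "\<lbrakk>x \<in> carrier A; y \<in> carrier A\<rbrakk> \<Longrightarrow> x \<curlyvee> y \<in> carrier A"
  "\<lbrakk>x \<in> carrier A; y \<in> carrier A\<rbrakk> \<Longrightarrow> x \<curlywedge> y \<in> carrier A"
  "\<lbrakk>x \<in> carrier A; y \<in> carrier A\<rbrakk> \<Longrightarrow> x \<otimes> y \<in> carrier A"
  "\<lbrakk>x \<in> carrier A; y \<in> carrier A\<rbrakk> \<Longrightarrow> x \<leadsto> y \<in> carrier A"
  "x \<in> carrier A \<Longrightarrow> \<sim> x \<in> carrier A"
  using algebra by (auto simp: rl_algebra_def rl_neg_def)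



section \<open>Identities behind the K-lattice axioms\<close>

lemma model_mult_assoc:
  "\<lbrakk>x \<in> carrier A; y \<in> carrier A; z \<in> carrier A\<rbrakk> \<Longrightarrow> (x \<otimes> y) \<otimes> z = x \<otimes> (y \<otimes> z)"
  by (rule law[of "Mult (Mult X Y) Z" "Mult X (Mult Y Z)" x y z])
    (auto simp: K_C_omega_ops rl_neg_def prod_eq_iff nat_diff_distribs ac_simps)

lemma model_mult_comm:
  "\<lbrakk>x \<in> carrier A; y \<in> carrier A\<rbrakk> \<Longrightarrow> x \<otimes> y = y \<otimes> x"
  by (rule law[of "Mult X Y" "Mult Y X" x y x])
    (auto simp: K_C_omega_ops rl_neg_def prod_eq_iff)

lemma model_one_mult:
  "x \<in> carrier A \<Longrightarrow> \<one> \<otimes> x = x"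
  by (rule law[of "Mult One X" "X" x x x])
    (auto simp: K_C_omega_ops rl_neg_def prod_eq_iff)

lemma model_vee_assoc:
  "\<lbrakk>x \<in> carrier A; y \<in> carrier A; z \<in> carrier A\<rbrakk> \<Longrightarrow> (x \<curlyvee> y) \<curlyvee> z = x \<curlyvee> (y \<curlyvee> z)"
  by (rule law[of "Vee (Vee X Y) Z" "Vee X (Vee Y Z)" x y z])
    (auto simp: K_C_omega_ops rl_neg_def prod_eq_iff)

lemma model_wedge_assoc:
  "\<lbrakk>x \<in> carrier A; y \<in> carrier A; z \<in> carrier A\<rbrakk> \<Longrightarrow> (x \<curlywedge> y) \<curlywedge> z = x \<curlywedge> (y \<curlywedge> z)"
  by (rule law[of "Wedge (Wedge X Y) Z" "Wedge X (Wedge Y Z)" x y z])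
    (auto simp: K_C_omega_ops rl_neg_def prod_eq_iff)

lemma model_vee_comm:
  "\<lbrakk>x \<in> carrier A; y \<in> carrier A\<rbrakk> \<Longrightarrow> x \<curlyvee> y = y \<curlyvee> x"
  by (rule law[of "Vee X Y" "Vee Y X" x y x])
    (auto simp: K_C_omega_ops rl_neg_def prod_eq_iff)

lemma model_wedge_comm:
  "\<lbrakk>x \<in> carrier A; y \<in> carrier A\<rbrakk> \<Longrightarrow> x \<curlywedge> y = y \<curlywedge> x"
  by (rule law[of "Wedge X Y" "Wedge Y X" x y x])
    (auto simp: K_C_omega_ops rl_neg_def prod_eq_iff)

lemma model_vee_wedge:
  "\<lbrakk>x \<in> carrier A; y \<in> carrier A\<rbrakk> \<Longrightarrow> x \<curlyvee> (x \<curlywedge> y) = x"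
  by (rule law[of "Vee X (Wedge X Y)" "X" x y x])
    (auto simp: K_C_omega_ops rl_neg_def prod_eq_iff)

lemma model_wedge_vee:
  "\<lbrakk>x \<in> carrier A; y \<in> carrier A\<rbrakk> \<Longrightarrow> x \<curlywedge> (x \<curlyvee> y) = x"
  by (rule law[of "Wedge X (Vee X Y)" "X" x y x])
    (auto simp: K_C_omega_ops rl_neg_def prod_eq_iff)

text \<open>Residuation is not an identity. It is replaced by four: this one and the next bound the
  two composites of multiplication by \<open>y\<close> and residuation by \<open>y\<close>, and the
  two after them make both maps monotone.\<close>

lemma model_mult_resid:
  "\<lbrakk>y \<in> carrier A; z \<in> carrier A\<rbrakk> \<Longrightarrow> ((y \<leadsto> z) \<otimes> y) \<curlywedge> z = (y \<leadsto> z) \<otimes> y"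
  by (rule law[of "Wedge (Mult (Resid Y Z) Y) Z" "Mult (Resid Y Z) Y" y y z])
    (auto simp: K_C_omega_ops rl_neg_def prod_eq_iff)

lemma model_resid_mult:
  "\<lbrakk>x \<in> carrier A; y \<in> carrier A\<rbrakk> \<Longrightarrow> x \<curlywedge> (y \<leadsto> (x \<otimes> y)) = x"
  by (rule law[of "Wedge X (Resid Y (Mult X Y))" "X" x y x])
    (auto simp: K_C_omega_ops rl_neg_def prod_eq_iff)

lemma model_resid_wedge:
  "\<lbrakk>x \<in> carrier A; y \<in> carrier A; z \<in> carrier A\<rbrakk> \<Longrightarrow> y \<leadsto> (x \<curlywedge> z) = (y \<leadsto> x) \<curlywedge> (y \<leadsto> z)"
  by (rule law[of "Resid Y (Wedge X Z)" "Wedge (Resid Y X) (Resid Y Z)" x y z])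
    (auto simp: K_C_omega_ops rl_neg_def prod_eq_iff nat_diff_distribs ac_simps)

lemma model_vee_mult:
  "\<lbrakk>x \<in> carrier A; y \<in> carrier A; z \<in> carrier A\<rbrakk> \<Longrightarrow> (x \<curlyvee> y) \<otimes> z = (x \<otimes> z) \<curlyvee> (y \<otimes> z)"
  by (rule law[of "Mult (Vee X Y) Z" "Vee (Mult X Z) (Mult Y Z)" x y z])
    (auto simp: K_C_omega_ops rl_neg_def prod_eq_iff nat_diff_distribs ac_simps)

lemma model_neg_neg:
  "x \<in> carrier A \<Longrightarrow> \<sim> (\<sim> x) = x"
  by (rule law[of "Neg (Neg X)" "X" x x x])
    (auto simp: K_C_omega_ops rl_neg_def prod_eq_iff)

text \<open>The condition that some element equals \<open>\<one>\<close> is no identity. Placing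
  \<open>\<one>\<close> at each of the three positions of both distributive laws gives six
  identities, starting here.\<close>

lemma model_one_wedge_vee:
  "\<lbrakk>y \<in> carrier A; z \<in> carrier A\<rbrakk> \<Longrightarrow> \<one> \<curlywedge> (y \<curlyvee> z) = (\<one> \<curlywedge> y) \<curlyvee> (\<one> \<curlywedge> z)"
  by (rule law[of "Wedge One (Vee Y Z)" "Vee (Wedge One Y) (Wedge One Z)" y y z])
    (auto simp: K_C_omega_ops rl_neg_def prod_eq_iff)

lemma model_wedge_one_vee:
  "\<lbrakk>x \<in> carrier A; z \<in> carrier A\<rbrakk> \<Longrightarrow> x \<curlywedge> (\<one> \<curlyvee> z) = (x \<curlywedge> \<one>) \<curlyvee> (x \<curlywedge> z)"
  by (rule law[of "Wedge X (Vee One Z)" "Vee (Cut X) (Wedge X Z)" x x z])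
    (auto simp: K_C_omega_ops rl_neg_def prod_eq_iff)

lemma model_wedge_vee_one:
  "\<lbrakk>x \<in> carrier A; y \<in> carrier A\<rbrakk> \<Longrightarrow> x \<curlywedge> (y \<curlyvee> \<one>) = (x \<curlywedge> y) \<curlyvee> (x \<curlywedge> \<one>)"
  by (rule law[of "Wedge X (Vee Y One)" "Vee (Wedge X Y) (Cut X)" x y x])
    (auto simp: K_C_omega_ops rl_neg_def prod_eq_iff)

lemma model_one_vee_wedge:
  "\<lbrakk>y \<in> carrier A; z \<in> carrier A\<rbrakk> \<Longrightarrow> \<one> \<curlyvee> (y \<curlywedge> z) = (\<one> \<curlyvee> y) \<curlywedge> (\<one> \<curlyvee> z)"
  by (rule law[of "Vee One (Wedge Y Z)" "Wedge (Vee One Y) (Vee One Z)" y y z])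
    (auto simp: K_C_omega_ops rl_neg_def prod_eq_iff)

lemma model_vee_one_wedge:
  "\<lbrakk>x \<in> carrier A; z \<in> carrier A\<rbrakk> \<Longrightarrow> x \<curlyvee> (\<one> \<curlywedge> z) = (x \<curlyvee> \<one>) \<curlywedge> (x \<curlyvee> z)"
  by (rule law[of "Vee X (Wedge One Z)" "Wedge (Vee X One) (Vee X Z)" x x z])
    (auto simp: K_C_omega_ops rl_neg_def prod_eq_iff)

lemma model_vee_wedge_one:
  "\<lbrakk>x \<in> carrier A; y \<in> carrier A\<rbrakk> \<Longrightarrow> x \<curlyvee> (y \<curlywedge> \<one>) = (x \<curlyvee> y) \<curlywedge> (x \<curlyvee> \<one>)"
  by (rule law[of "Vee X (Cut Y)" "Wedge (Vee X Y) (Vee X One)" x y x])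
    (auto simp: K_C_omega_ops rl_neg_def prod_eq_iff)

lemma model_mult_one:
  "x \<in> carrier A \<Longrightarrow> x \<otimes> \<one> = x"
  by (rule law[of "Mult X One" "X" x x x])
    (auto simp: K_C_omega_ops rl_neg_def prod_eq_iff)

lemma model_K1:
  "\<lbrakk>x \<in> carrier A; y \<in> carrier A\<rbrakk> \<Longrightarrow> (x \<otimes> y) \<curlywedge> \<one> = (x \<curlywedge> \<one>) \<otimes> (y \<curlywedge> \<one>)"
  by (rule law[of "Cut (Mult X Y)" "Mult (Cut X) (Cut Y)" x y x])
    (auto simp: K_C_omega_ops rl_neg_def prod_eq_iff)

lemma model_K2:
  "\<lbrakk>x \<in> carrier A; y \<in> carrier A\<rbrakk> \<Longrightarrow> ((x \<curlywedge> \<one>) \<leadsto> y) \<curlywedge> (((\<sim> y) \<curlywedge> \<one>) \<leadsto> (\<sim> x)) = x \<leadsto> y"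
  by (rule law[of "Wedge (Resid (Cut X) Y) (Resid (Cut (Neg Y)) (Neg X))" "Resid X Y" x y x])
    (auto simp: K_C_omega_ops rl_neg_def prod_eq_iff)

text \<open>Variables cannot be restricted to the negative cone; instead
  \<open>x \<curlywedge> \<one>\<close> ranges over exactly its elements. Residuals are cut by
  \<open>\<one>\<close> to return to the cone.\<close>

lemma model_cone_hoop:
  "\<lbrakk>x \<in> carrier A; y \<in> carrier A\<rbrakk> \<Longrightarrow>
    (x \<curlywedge> \<one>) \<otimes> (((x \<curlywedge> \<one>) \<leadsto> (y \<curlywedge> \<one>)) \<curlywedge> \<one>) = (y \<curlywedge> \<one>) \<otimes> (((y \<curlywedge> \<one>) \<leadsto> (x \<curlywedge> \<one>)) \<curlywedge> \<one>)"
  by (rule law[of "Mult (Cut X) (Cut (Resid (Cut X) (Cut Y)))"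
        "Mult (Cut Y) (Cut (Resid (Cut Y) (Cut X)))" x y x])
    (auto simp: K_C_omega_ops rl_neg_def prod_eq_iff)

text \<open>In \<open>K C_omega\<close>, if the cut elements are \<open>(r, 0)\<close> and
  \<open>(s, 0)\<close>, then their residual here is \<open>(s, r)\<close>. This identity and the
  next recover its two coordinates; this one also yields cancellation in the cone.\<close>

lemma model_cone_cancel:
  "\<lbrakk>x \<in> carrier A; y \<in> carrier A\<rbrakk> \<Longrightarrow> ((x \<curlywedge> \<one>) \<leadsto> ((x \<curlywedge> \<one>) \<otimes> (y \<curlywedge> \<one>))) \<curlywedge> \<one> = y \<curlywedge> \<one>"
  by (rule law[of "Cut (Resid (Cut X) (Mult (Cut X) (Cut Y)))" "Cut Y" x y x])
    (auto simp: K_C_omega_ops rl_neg_def prod_eq_iff)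

lemma model_cone_neg_surj:
  "\<lbrakk>x \<in> carrier A; y \<in> carrier A\<rbrakk> \<Longrightarrow> (\<sim> ((x \<curlywedge> \<one>) \<leadsto> ((x \<curlywedge> \<one>) \<otimes> (y \<curlywedge> \<one>)))) \<curlywedge> \<one> = x \<curlywedge> \<one>"
  by (rule law[of "Cut (Neg (Resid (Cut X) (Mult (Cut X) (Cut Y))))" "Cut X" x y x])
    (auto simp: K_C_omega_ops rl_neg_def prod_eq_iff)

text \<open>From here to \<open>model_cone_neg_resid\<close>, the coordinates of a result are
  computed from those of the arguments. Together with \<open>model_K1\<close> this makes
  \<open>K_coordinates\<close> a homomorphism.\<close>

lemma model_cone_vee:
  "\<lbrakk>x \<in> carrier A; y \<in> carrier A\<rbrakk> \<Longrightarrow> (x \<curlyvee> y) \<curlywedge> \<one> = (x \<curlywedge> \<one>) \<curlyvee> (y \<curlywedge> \<one>)"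
  by (rule law[of "Cut (Vee X Y)" "Vee (Cut X) (Cut Y)" x y x])
    (auto simp: K_C_omega_ops rl_neg_def prod_eq_iff)

lemma model_cone_neg_vee:
  "\<lbrakk>x \<in> carrier A; y \<in> carrier A\<rbrakk> \<Longrightarrow> (\<sim> (x \<curlyvee> y)) \<curlywedge> \<one> = ((\<sim> x) \<curlywedge> \<one>) \<curlywedge> ((\<sim> y) \<curlywedge> \<one>)"
  by (rule law[of "Cut (Neg (Vee X Y))" "Wedge (Cut (Neg X)) (Cut (Neg Y))" x y x])
    (auto simp: K_C_omega_ops rl_neg_def prod_eq_iff)

lemma model_cone_wedge:
  "\<lbrakk>x \<in> carrier A; y \<in> carrier A\<rbrakk> \<Longrightarrow> (x \<curlywedge> y) \<curlywedge> \<one> = (x \<curlywedge> \<one>) \<curlywedge> (y \<curlywedge> \<one>)"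
  by (rule law[of "Cut (Wedge X Y)" "Wedge (Cut X) (Cut Y)" x y x])
    (auto simp: K_C_omega_ops rl_neg_def prod_eq_iff)

lemma model_cone_neg_wedge:
  "\<lbrakk>x \<in> carrier A; y \<in> carrier A\<rbrakk> \<Longrightarrow> (\<sim> (x \<curlywedge> y)) \<curlywedge> \<one> = ((\<sim> x) \<curlywedge> \<one>) \<curlyvee> ((\<sim> y) \<curlywedge> \<one>)"
  by (rule law[of "Cut (Neg (Wedge X Y))" "Vee (Cut (Neg X)) (Cut (Neg Y))" x y x])
    (auto simp: K_C_omega_ops rl_neg_def prod_eq_iff)

lemma model_cone_neg_mult:
  "\<lbrakk>x \<in> carrier A; y \<in> carrier A\<rbrakk> \<Longrightarrow>
    (\<sim> (x \<otimes> y)) \<curlywedge> \<one> = (((x \<curlywedge> \<one>) \<leadsto> ((\<sim> y) \<curlywedge> \<one>)) \<curlywedge> \<one>) \<curlywedge> (((y \<curlywedge> \<one>) \<leadsto> ((\<sim> x) \<curlywedge> \<one>)) \<curlywedge> \<one>)"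
  by (rule law[of "Cut (Neg (Mult X Y))"
        "Wedge (Cut (Resid (Cut X) (Cut (Neg Y)))) (Cut (Resid (Cut Y) (Cut (Neg X))))" x y x])
    (auto simp: K_C_omega_ops rl_neg_def prod_eq_iff)

lemma model_cone_resid:
  "\<lbrakk>x \<in> carrier A; y \<in> carrier A\<rbrakk> \<Longrightarrow>
    (x \<leadsto> y) \<curlywedge> \<one> = (((x \<curlywedge> \<one>) \<leadsto> (y \<curlywedge> \<one>)) \<curlywedge> \<one>) \<curlywedge> ((((\<sim> y) \<curlywedge> \<one>) \<leadsto> ((\<sim> x) \<curlywedge> \<one>)) \<curlywedge> \<one>)"
  by (rule law[of "Cut (Resid X Y)"
        "Wedge (Cut (Resid (Cut X) (Cut Y))) (Cut (Resid (Cut (Neg Y)) (Cut (Neg X))))" x y x])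
    (auto simp: K_C_omega_ops rl_neg_def prod_eq_iff)

lemma model_cone_neg_resid:
  "\<lbrakk>x \<in> carrier A; y \<in> carrier A\<rbrakk> \<Longrightarrow> (\<sim> (x \<leadsto> y)) \<curlywedge> \<one> = (x \<curlywedge> \<one>) \<otimes> ((\<sim> y) \<curlywedge> \<one>)"
  by (rule law[of "Cut (Neg (Resid X Y))" "Mult (Cut X) (Cut (Neg Y))" x y x])
    (auto simp: K_C_omega_ops rl_neg_def prod_eq_iff)

text \<open>In \<open>K C_omega\<close> negation swaps coordinates, so the two cuts of
  \<open>(r, s)\<close> are \<open>(r, 0)\<close> and \<open>(s, 0)\<close>, and the residual
  reassembles the pair. This gives injectivity of the coordinates.\<close>

lemma model_reconstruct:
  "x \<in> carrier A \<Longrightarrow> ((\<sim> x) \<curlywedge> \<one>) \<leadsto> ((x \<curlywedge> \<one>) \<otimes> ((\<sim> x) \<curlywedge> \<one>)) = x"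
  by (rule law[of "Resid (Cut (Neg X)) (Mult (Cut X) (Cut (Neg X)))" "X" x x x])
    (auto simp: K_C_omega_ops rl_neg_def prod_eq_iff)

lemma model_le_iff_vee:
  "\<lbrakk>x \<in> carrier A; y \<in> carrier A\<rbrakk> \<Longrightarrow> x \<preceq> y \<longleftrightarrow> x \<curlyvee> y = y"
  unfolding rl_le_def by (metis model_vee_wedge model_wedge_vee model_vee_comm model_wedge_comm)

lemma model_le_trans:
  "\<lbrakk>x \<preceq> y; y \<preceq> z; x \<in> carrier A; y \<in> carrier A; z \<in> carrier A\<rbrakk> \<Longrightarrow> x \<preceq> z"
  unfolding rl_le_def by (metis model_wedge_assoc)

lemma model_residuation:
  assumes c: "x \<in> carrier A" "y \<in> carrier A" "z \<in> carrier A"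
  shows "x \<otimes> y \<preceq> z \<longleftrightarrow> x \<preceq> y \<leadsto> z"
proof
  assume "x \<otimes> y \<preceq> z"
  then have "(y \<leadsto> x \<otimes> y) \<curlywedge> (y \<leadsto> z) = y \<leadsto> x \<otimes> y"
    using c model_resid_wedge[of "x \<otimes> y" y z] by (simp add: closed rl_le_def)
  moreover have "x \<preceq> y \<leadsto> x \<otimes> y" using c by (simp add: rl_le_def model_resid_mult)
  ultimately show "x \<preceq> y \<leadsto> z" using c closed model_le_trans unfolding rl_le_def by metis
next
  assume "x \<preceq> y \<leadsto> z"
  then have "x \<otimes> y \<curlyvee> (y \<leadsto> z) \<otimes> y = (y \<leadsto> z) \<otimes> y"
    using c model_vee_mult[of x "y \<leadsto> z" y] by (simp add: closed model_le_iff_vee)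
  then have "x \<otimes> y \<preceq> (y \<leadsto> z) \<otimes> y" using c by (simp add: closed model_le_iff_vee)
  moreover have "(y \<leadsto> z) \<otimes> y \<preceq> z" using c by (simp add: rl_le_def model_mult_resid)
  ultimately show "x \<otimes> y \<preceq> z" using c closed model_le_trans by meson
qed

lemma K_lattice: "K_lattice A"
proof unfold_locales
  fix x y z assume c: "x \<in> carrier A" "y \<in> carrier A" "z \<in> carrier A"
    and one: "x = \<one> \<or> y = \<one> \<or> z = \<one>"
  then show "x \<curlywedge> (y \<curlyvee> z) = (x \<curlywedge> y) \<curlyvee> (x \<curlywedge> z)"
    using model_one_wedge_vee model_wedge_one_vee model_wedge_vee_one by blast
  show "x \<curlyvee> (y \<curlywedge> z) = (x \<curlyvee> y) \<curlywedge> (x \<curlyvee> z)"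
    using c one model_one_vee_wedge model_vee_one_wedge model_vee_wedge_one by blast
qed (simp_all add: closed model_mult_assoc model_mult_one model_one_mult model_vee_assoc
    model_wedge_assoc model_vee_wedge model_wedge_vee model_residuation model_neg_neg model_K1 model_K2,
    (rule model_mult_comm model_vee_comm model_wedge_comm; assumption)+)

end

section \<open>The negative cone\<close>

text \<open>The residual of two elements below \<open>\<one>\<close> may leave the cone: in
  \<open>K C_omega\<close> that of \<open>(r, 0)\<close> and \<open>(s, 0)\<close> is
  \<open>(s - r, r)\<close>. Cutting it by \<open>\<one>\<close> gives the residual within the
  cone.\<close>

definition neg_cone :: "'a rl \<Rightarrow> 'a rl" where
  "neg_cone A = \<lparr>carrier = {x \<in> carrier A. x \<preceq>\<^bsub>A\<^esub> \<one>\<^bsub>A\<^esub>}, mult = mult A, one = one A,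
     vee = vee A, wedge = wedge A, resid = (\<lambda>x y. (x \<leadsto>\<^bsub>A\<^esub> y) \<curlywedge>\<^bsub>A\<^esub> \<one>\<^bsub>A\<^esub>)\<rparr>"

lemma neg_cone_simps:
  "carrier (neg_cone A) = {x \<in> carrier A. x \<preceq>\<^bsub>A\<^esub> \<one>\<^bsub>A\<^esub>}"
  "\<one>\<^bsub>neg_cone A\<^esub> = \<one>\<^bsub>A\<^esub>"
  "x \<otimes>\<^bsub>neg_cone A\<^esub> y = x \<otimes>\<^bsub>A\<^esub> y"
  "x \<curlyvee>\<^bsub>neg_cone A\<^esub> y = x \<curlyvee>\<^bsub>A\<^esub> y"
  "x \<curlywedge>\<^bsub>neg_cone A\<^esub> y = x \<curlywedge>\<^bsub>A\<^esub> y"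
  "x \<leadsto>\<^bsub>neg_cone A\<^esub> y = (x \<leadsto>\<^bsub>A\<^esub> y) \<curlywedge>\<^bsub>A\<^esub> \<one>\<^bsub>A\<^esub>"
  "x \<preceq>\<^bsub>neg_cone A\<^esub> y \<longleftrightarrow> x \<preceq>\<^bsub>A\<^esub> y"
  by (simp_all add: neg_cone_def rl_le_def)

text \<open>In \<open>K L\<close> the meet of \<open>(a, b)\<close> with the unit is
  \<open>(a, \<one>)\<close> and negation swaps coordinates, so the two cuts recover
  \<open>a\<close> and \<open>b\<close>.\<close>

definition K_coordinates :: "'a rl \<Rightarrow> 'a \<Rightarrow> 'a \<times> 'a" where
  "K_coordinates A x = (x \<curlywedge>\<^bsub>A\<^esub> \<one>\<^bsub>A\<^esub>, \<sim>\<^bsub>A\<^esub> x \<curlywedge>\<^bsub>A\<^esub> \<one>\<^bsub>A\<^esub>)"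

context K_C_omega_model
begin

lemma cancellative_hoop_neg_cone: "cancellative_hoop (neg_cone A)"
proof -
  interpret K_lattice A by (rule K_lattice)
  have mult: "x \<otimes> y \<preceq> \<one>" if "x \<preceq> \<one>" "y \<preceq> \<one>" "x \<in> carrier A" "y \<in> carrier A" for x y
    using mult_mono[of x \<one> y \<one>] that by simp
  have wedge: "x \<curlywedge> y \<preceq> \<one>" if "x \<preceq> \<one>" "x \<in> carrier A" "y \<in> carrier A" for x y
    using le_trans[OF wedge_lower1 that(1)] that by (simp add: closed)
  have "x \<preceq> (y \<leadsto> z) \<curlywedge> \<one> \<longleftrightarrow> x \<preceq> y \<leadsto> z"
    if "x \<preceq> \<one>" "x \<in> carrier A" "y \<in> carrier A" "z \<in> carrier A" for x y z
    using that wedge_greatest le_trans[OF _ wedge_lower1] by (metis closed(1,3,5))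
  then have residuation': "x \<otimes> y \<preceq> z \<longleftrightarrow> x \<preceq> (y \<leadsto> z) \<curlywedge> \<one>"
    if "x \<preceq> \<one>" "x \<in> carrier A" "y \<in> carrier A" "z \<in> carrier A" for x y z
    using that residuation by simp
  have hoop: "x \<otimes> ((x \<leadsto> y) \<curlywedge> \<one>) = y \<otimes> ((y \<leadsto> x) \<curlywedge> \<one>)"
    if "x \<preceq> \<one>" "y \<preceq> \<one>" "x \<in> carrier A" "y \<in> carrier A" for x y
    using model_cone_hoop[of x y] that by (simp add: rl_le_def)
  have cancel: "y = z"
    if "x \<otimes> y = x \<otimes> z" "x \<preceq> \<one>" "y \<preceq> \<one>" "z \<preceq> \<one>" "x \<in> carrier A" "y \<in> carrier A" "z \<in> carrier A"
    for x y z
    using model_cone_cancel[of x y] model_cone_cancel[of x z] that by (simp add: rl_le_def)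
  show ?thesis
    by unfold_locales
      (simp_all add: neg_cone_simps closed m_assoc mult wedge vee_least le_refl vee_assoc wedge_assoc
        vee_absorb wedge_absorb wedge_lower2 flip: residuation',
        (blast intro: m_comm vee_comm wedge_comm hoop cancel)+)
qed

lemma K_coordinates_hom: "K_coordinates A \<in> rl_hom A (K (neg_cone A))"
proof -
  interpret K_lattice A by (rule K_lattice)
  have "\<one> \<curlywedge> \<one> = \<one>" "\<sim> \<one> \<curlywedge> \<one> = \<one>"
    by (simp_all add: wedge_idem one_resid rl_neg_def)
  moreover have "K_coordinates A x \<in> carrier (K (neg_cone A))" if "x \<in> carrier A" for x
    using that by (simp add: K_coordinates_def K_simps neg_cone_simps closed wedge_lower2)
  moreover have "K_coordinates A (x \<curlyvee> y) = K_coordinates A x \<curlyvee>\<^bsub>K (neg_cone A)\<^esub> K_coordinates A y \<and>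
      K_coordinates A (x \<curlywedge> y) = K_coordinates A x \<curlywedge>\<^bsub>K (neg_cone A)\<^esub> K_coordinates A y \<and>
      K_coordinates A (x \<otimes> y) = K_coordinates A x \<otimes>\<^bsub>K (neg_cone A)\<^esub> K_coordinates A y \<and>
      K_coordinates A (x \<leadsto> y) = K_coordinates A x \<leadsto>\<^bsub>K (neg_cone A)\<^esub> K_coordinates A y"
    if xy: "x \<in> carrier A" "y \<in> carrier A" for x y
    by (simp only: K_coordinates_def K_simps neg_cone_simps model_cone_vee[OF xy]
        model_cone_neg_vee[OF xy] model_cone_wedge[OF xy] model_cone_neg_wedge[OF xy]
        model_K1[OF xy] model_cone_neg_mult[OF xy] model_cone_resid[OF xy] model_cone_neg_resid[OF xy])
  ultimately show ?thesis
    by (simp add: rl_hom_def K_coordinates_def[of A "\<one>"] K_simps neg_cone_simps)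
qed

lemma K_coordinates_inj: "inj_on (K_coordinates A) (carrier A)"
proof (rule inj_onI)
  fix x y assume xy: "x \<in> carrier A" "y \<in> carrier A" and "K_coordinates A x = K_coordinates A y"
  then have eq: "x \<curlywedge> \<one> = y \<curlywedge> \<one>" "\<sim> x \<curlywedge> \<one> = \<sim> y \<curlywedge> \<one>" by (simp_all add: K_coordinates_def)
  show "x = y" by (rule model_reconstruct[OF xy(1), unfolded eq model_reconstruct[OF xy(2)], symmetric])
qed

lemma K_coordinates_surj: "K_coordinates A ` carrier A = carrier (K (neg_cone A))"
proof
  show "K_coordinates A ` carrier A \<subseteq> carrier (K (neg_cone A))"
    using K_coordinates_hom by (auto simp: rl_hom_def)
  show "carrier (K (neg_cone A)) \<subseteq> K_coordinates A ` carrier A"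
  proof
    fix p assume "p \<in> carrier (K (neg_cone A))"
    then obtain c d where p: "p = (c, d)" "c \<in> carrier A" "d \<in> carrier A" "c \<curlywedge> \<one> = c" "d \<curlywedge> \<one> = d"
      by (auto simp: K_simps neg_cone_simps rl_le_def)
    \<comment> \<open>The preimage imitates \<open>K C_omega\<close>, where this residual of cone
      elements is the pair with first coordinate from \<open>c\<close> and second from
      \<open>d\<close>.\<close>
    then have "K_coordinates A (d \<leadsto> d \<otimes> c) = p"
      using model_cone_cancel[of d c] model_cone_neg_surj[of d c] by (simp add: K_coordinates_def)
    moreover have "d \<leadsto> d \<otimes> c \<in> carrier A" using p by (simp add: closed)
    ultimately show "p \<in> K_coordinates A ` carrier A" by blast
  qed
qed

lemma mem_K_class: "A \<in> K_class (cancellative_hoops :: 'a rl set)"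
  unfolding K_class_def
proof (intro CollectI conjI bexI[of _ "neg_cone A"])
  show "A \<in> KL" by (simp add: KL_def K_lattice)
  show "neg_cone A \<in> cancellative_hoops"
    by (simp add: mem_cancellative_hoops cancellative_hoop_neg_cone)
  show "embeds_in A (K (neg_cone A))"
    unfolding embeds_in_def using K_coordinates_hom K_coordinates_inj by blast
qed

end

section \<open>Powers of an element as a copy of \<open>C_omega\<close>\<close>

context cancellative_hoop
begin

lemma nat_pow_antimono:
  "\<lbrakk>m \<le> n; a \<in> carrier A\<rbrakk> \<Longrightarrow> a [^] n \<preceq> a [^] (m::nat)"
  by (metis le_add_diff_inverse mult_le1 nat_pow_closed nat_pow_mult)

lemma nat_pow_lattice:
  assumes "a \<in> carrier A"
  shows "a [^] max m n = a [^] m \<curlywedge> a [^] n \<and> a [^] min m n = a [^] m \<curlyvee> a [^] (n::nat)"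
proof (cases "m \<le> n")
  case True
  then show ?thesis using nat_pow_antimono[OF True assms] assms
      le_iff_vee[of "a [^] n" "a [^] m"] vee_comm[of "a [^] n" "a [^] m"]
      wedge_comm[of "a [^] n" "a [^] m"] by (simp add: rl_le_def)
next
  case False
  then have "n \<le> m" by simp
  then show ?thesis using nat_pow_antimono[of n m a] assms
      le_iff_vee[of "a [^] m" "a [^] n"] by (simp add: rl_le_def)
qed

lemma nat_pow_resid:
  assumes "a \<in> carrier A"
  shows "a [^] (n - m) = a [^] m \<leadsto> a [^] (n::nat)"
proof (cases "m \<le> n")
  case True
  then have "a [^] n = a [^] (n - m) \<otimes> a [^] m" using assms by (simp add: nat_pow_mult)
  then have "a [^] m \<leadsto> a [^] n = \<one> \<leadsto> a [^] (n - m)"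
    using resid_mult_cancel[of \<one> "a [^] (n - m)" "a [^] m"] assms by simp
  then show ?thesis using assms by (simp add: one_resid)
next
  case False
  then show ?thesis using nat_pow_antimono[of n m a] assms by (simp add: le_iff_resid)
qed

text \<open>Cancelling equal powers gives \<open>a [^] (n - m) = \<one>\<close> with a positive
  exponent; this power lies below \<open>a\<close>, forcing \<open>a = \<one>\<close>.\<close>

lemma nat_pow_inj:
  assumes "a \<in> carrier A" "a \<noteq> \<one>"
  shows "inj (\<lambda>n::nat. a [^] n)"
proof (rule linorder_injI)
  fix m n :: nat assume "m < n"
  show "a [^] m \<noteq> a [^] n"
  proof
    assume "a [^] m = a [^] n"
    moreover have "a [^] m \<otimes> a [^] (n - m) = a [^] n"
      using assms \<open>m < n\<close> by (simp add: nat_pow_mult)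
    ultimately have "a [^] m \<otimes> \<one> = a [^] m \<otimes> a [^] (n - m)" using assms by simp
    then have "a [^] (n - m) = \<one>" using assms cancel by (metis nat_pow_closed one_closed)
    moreover have "a [^] (n - m) \<preceq> a [^] (1::nat)"
      using assms \<open>m < n\<close> by (intro nat_pow_antimono) auto
    ultimately have "\<one> \<preceq> a" using assms by simp
    then show False using assms integral le_antisym by blast
  qed
qed

end

lemma K_C_omega_embeds:
  assumes "cancellative_hoop A" and a: "a \<in> carrier A" "a \<noteq> \<one>\<^bsub>A\<^esub>"
  shows "embeds_in (K C_omega) (K A)"
proof -
  interpret cancellative_hoop A by fact
  let ?h = "\<lambda>n::nat. a [^]\<^bsub>A\<^esub> n"
  have "?h \<in> rl_hom C_omega A"
    using a by (simp add: rl_hom_def C_omega_simps nat_pow_mult nat_pow_lattice nat_pow_resid)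
  then have "map_prod ?h ?h \<in> rl_hom (K C_omega) (K A)"
    by (rule map_prod_rl_hom_K[OF _ rl_algebra_C_omega])
  moreover have "inj (map_prod ?h ?h)" using nat_pow_inj[OF a] by (intro prod.inj_map)
  ultimately show ?thesis unfolding embeds_in_def using inj_on_subset by blast
qed

section \<open>Nontrivial models\<close>

lemma satisfies_surj_hom:
  assumes "h \<in> rl_hom A B" "h ` carrier A = carrier B" "rl_algebra A" "satisfies A e"
  shows "satisfies B e"
  unfolding satisfies_def
proof (intro allI impI)
  fix v :: "nat \<Rightarrow> 'b" assume "range v \<subseteq> carrier B"
  then have "\<forall>n. \<exists>x\<in>carrier A. h x = v n" using assms(2) by (metis image_iff rangeI subsetD)
  then obtain w where w: "\<And>n. w n \<in> carrier A" "\<And>n. h (w n) = v n" by metis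
  then have "range w \<subseteq> carrier A" "h \<circ> w = v" by auto
  then show "eval_term B v (fst e) = eval_term B v (snd e)"
    using eval_term_hom[OF assms(1,3), of w] assms(4) by (metis satisfies_def)
qed

context K_C_omega_model
begin

lemma K_C_omega_embeds_in_K_neg_cone:
  assumes "carrier A \<noteq> {\<one>}"
  shows "embeds_in (K C_omega) (K (neg_cone A))"
proof -
  interpret K_lattice A by (rule K_lattice)
  obtain x where x: "x \<in> carrier A" "x \<noteq> \<one>" using assms closed(1) by blast
  \<comment> \<open>If both coordinates were \<open>\<one>\<close>, then \<open>x\<close> would be
    reconstructed as \<open>\<one> \<leadsto> \<one> \<otimes> \<one> = \<one>\<close>.\<close>
  have "x \<curlywedge> \<one> \<noteq> \<one> \<or> \<sim> x \<curlywedge> \<one> \<noteq> \<one>"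
    using model_reconstruct[OF x(1)] x by (auto simp: one_resid)
  then obtain a where "a \<in> carrier (neg_cone A)" "a \<noteq> \<one>\<^bsub>neg_cone A\<^esub>"
    using x by (metis (no_types, lifting) closed(1,3,6) mem_Collect_eq neg_cone_simps(1,2) wedge_lower2)
  then show ?thesis by (rule K_C_omega_embeds[OF cancellative_hoop_neg_cone])
qed

text \<open>Identities pass from \<open>A\<close> to its image \<open>K (neg_cone A)\<close> under
  the coordinates, and from there to the embedded \<open>K C_omega\<close>.\<close>

lemma satisfies_K_C_omega_if_nontrivial:
  assumes "carrier A \<noteq> {\<one>}" "satisfies A e"
  shows "satisfies (K C_omega) e"
  using satisfies_embeds_in[OF K_C_omega_embeds_in_K_neg_cone[OF assms(1)]
      rl_algebra_K[OF rl_algebra_C_omega]]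
    satisfies_surj_hom[OF K_coordinates_hom K_coordinates_surj algebra assms(2)] by blast

lemma infinite_if_nontrivial:
  assumes "carrier A \<noteq> {\<one>}"
  shows "infinite (carrier A)"
proof
  assume "finite (carrier A)"
  then have "finite (carrier (K (neg_cone A)))" by (simp flip: K_coordinates_surj)
  moreover obtain h where "h \<in> rl_hom (K C_omega) (K (neg_cone A))" "inj h"
    using K_C_omega_embeds_in_K_neg_cone[OF assms] by (auto simp: embeds_in_def K_C_omega_ops)
  then have "range h \<subseteq> carrier (K (neg_cone A))" by (auto simp: rl_hom_def K_C_omega_ops)
  ultimately have "finite (UNIV :: (nat \<times> nat) set)"
    using \<open>inj h\<close> finite_imageD finite_subset by blast
  then show False by (simp add: finite_prod)
qed

end

section \<open>The trivial variety and copies of algebras on other types\<close>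

lemma trivial_satisfies:
  assumes "rl_algebra A" "carrier A = {\<one>\<^bsub>A\<^esub>}"
  shows "satisfies A e"
  using eval_term_closed[OF assms(1)] assms(2) by (simp add: satisfies_def)

lemma models_trivial: "models {(Var 0, One)} = {A. rl_algebra A \<and> carrier A = {\<one>\<^bsub>A\<^esub>}}"
proof -
  have "carrier A = {\<one>\<^bsub>A\<^esub>}" if "rl_algebra A" "satisfies A (Var 0, One)" for A :: "'a rl"
  proof -
    have "x = \<one>\<^bsub>A\<^esub>" if "x \<in> carrier A" for x
      using \<open>satisfies A (Var 0, One)\<close> that
      unfolding satisfies_def by (auto dest: spec[of _ "\<lambda>_. x"])
    then show ?thesis using that(1) by (auto simp: rl_algebra_def)
  qed
  then show ?thesis by (auto simp: models_def intro: trivial_satisfies)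
qed

text \<open>For injective \<open>f\<close> this is an isomorphic copy of \<open>A\<close> on another
  type. It brings \<open>K C_omega\<close>, which lives on pairs of naturals, into the type over
  which classes are taken.\<close>

definition transport :: "('a \<Rightarrow> 'b) \<Rightarrow> 'a rl \<Rightarrow> 'b rl" where
  "transport f A = \<lparr>carrier = f ` carrier A,
     mult = (\<lambda>x y. f (inv_into UNIV f x \<otimes>\<^bsub>A\<^esub> inv_into UNIV f y)), one = f \<one>\<^bsub>A\<^esub>,
     vee = (\<lambda>x y. f (inv_into UNIV f x \<curlyvee>\<^bsub>A\<^esub> inv_into UNIV f y)),
     wedge = (\<lambda>x y. f (inv_into UNIV f x \<curlywedge>\<^bsub>A\<^esub> inv_into UNIV f y)),
     resid = (\<lambda>x y. f (inv_into UNIV f x \<leadsto>\<^bsub>A\<^esub> inv_into UNIV f y))\<rparr>"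

lemma
  assumes "inj f" "rl_algebra A"
  shows rl_algebra_transport: "rl_algebra (transport f A)"
    and transport_embeds_in: "embeds_in (transport f A) A"
proof -
  show "rl_algebra (transport f A)"
    using assms by (auto simp: transport_def rl_algebra_def)
  have "inv_into UNIV f \<in> rl_hom (transport f A) A" using assms by (auto simp: transport_def rl_hom_def)
  moreover have "inj_on (inv_into UNIV f) (carrier (transport f A))"
    using assms by (auto simp: transport_def intro: inj_onI)
  ultimately show "embeds_in (transport f A) A" unfolding embeds_in_def by blast
qed

lemma ex_nontrivial_K_C_omega_model:
  assumes "infinite (UNIV :: 'u set)"
  obtains A :: "'u rl" where "A \<in> generated_variety (K C_omega)" "carrier A \<noteq> {\<one>\<^bsub>A\<^esub>}"
proof -
  obtain g :: "nat \<Rightarrow> 'u" where "inj g" using infinite_countable_subset[OF assms] by blast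
  then have f: "inj (g \<circ> prod_encode)" by (simp add: inj_compose inj_prod_encode)
  let ?A = "transport (g \<circ> prod_encode) (K C_omega)"
  have alg: "rl_algebra (K C_omega)" by (rule rl_algebra_K[OF rl_algebra_C_omega])
  have "K_C_omega_model ?A"
    by unfold_locales
      (use rl_algebra_transport[OF f alg] satisfies_embeds_in[OF transport_embeds_in[OF f alg]] in auto)
  moreover have "carrier ?A \<noteq> {\<one>\<^bsub>?A\<^esub>}"
  proof
    assume "carrier ?A = {\<one>\<^bsub>?A\<^esub>}"
    then have "finite (range (g \<circ> prod_encode))" by (simp add: transport_def K_C_omega_ops)
    then show False using f finite_imageD by (fastforce simp: finite_prod)
  qed
  ultimately show ?thesis using that mem_generated_variety_K_C_omega by blast
qed

text \<open>Classes are relative to the type \<open>'u\<close>, while hoops may live elsewhere; the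
  second conjunct shows that hoops on any type \<open>'b\<close> yield no further members.
  Nontrivial members of the variety are infinite, so an infinite \<open>'u\<close> is what gives
  them room.\<close>

theorem theorem4p3:
  assumes "infinite (UNIV :: 'u set)"
  shows "K_class (cancellative_hoops :: 'u rl set) = (generated_variety (K C_omega) :: 'u rl set)
    \<and> K_class (cancellative_hoops :: 'b rl set) \<subseteq> (generated_variety (K C_omega) :: 'u rl set)
    \<and> atom_of (subvarieties (KL :: 'u rl set)) (generated_variety (K C_omega))
    \<and> \<not> (\<exists>B :: 'u rl. rl_algebra B \<and> finite (carrier B)
          \<and> generated_variety B = (generated_variety (K C_omega) :: 'u rl set))"
proof (intro conjI)
  let ?V = "generated_variety (K C_omega) :: 'u rl set"
  let ?T = "models {(Var 0, One)} :: 'u rl set"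
  have alg: "rl_algebra (K C_omega)" by (rule rl_algebra_K[OF rl_algebra_C_omega])
  obtain N :: "'u rl" where "N \<in> ?V" "carrier N \<noteq> {\<one>\<^bsub>N\<^esub>}"
    by (rule ex_nontrivial_K_C_omega_model[OF assms])
  then have N: "N \<in> ?V" "N \<notin> ?T" by (simp_all add: models_trivial)
  show "K_class (cancellative_hoops :: 'u rl set) = ?V"
    using K_class_cancellative_hoops_subset K_C_omega_model.mem_K_class
    by (auto simp: mem_generated_variety_K_C_omega)
  show "K_class (cancellative_hoops :: 'b rl set) \<subseteq> ?V"
    by (rule K_class_cancellative_hoops_subset)
  have "?V \<subseteq> KL"
    using K_C_omega_model.K_lattice by (auto simp: mem_generated_variety_K_C_omega KL_def)
  moreover have "variety ?V" unfolding variety_def generated_variety_eq[OF alg] by blast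
  ultimately have V: "?V \<in> subvarieties KL" by (simp add: subvarieties_def)
  have T: "?T \<subseteq> U" if "variety U" for U :: "'u rl set"
    using that trivial_satisfies unfolding variety_def models_trivial by (auto simp: models_def)
  have "?T \<in> subvarieties KL"
    using T[OF \<open>variety ?V\<close>] \<open>?V \<subseteq> KL\<close> by (auto simp: subvarieties_def variety_def)
  moreover have "U = ?T \<or> U = ?V" if U: "variety U" "U \<subseteq> ?V" for U
  proof (cases "U \<subseteq> ?T")
    case True
    then show ?thesis using T[OF U(1)] by blast
  next
    case False
    then obtain A where "A \<in> U" "A \<notin> ?T" by blast
    then interpret K_C_omega_model A using U(2) mem_generated_variety_K_C_omega by blast
    have "carrier A \<noteq> {\<one>\<^bsub>A\<^esub>}" using \<open>A \<notin> ?T\<close> algebra by (simp add: models_trivial)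
    moreover obtain E where E: "U = models E" using U(1) by (auto simp: variety_def)
    \<comment> \<open>A subvariety with a nontrivial member \<open>A\<close> only has identities of
      \<open>A\<close>, and these hold in \<open>K C_omega\<close>.\<close>
    ultimately have "K C_omega \<in> models E"
      using \<open>A \<in> U\<close> satisfies_K_C_omega_if_nontrivial alg by (auto simp: E models_def)
    then have "?V \<subseteq> U" unfolding generated_variety_def E by blast
    then show ?thesis using U(2) by blast
  qed
  ultimately show "atom_of (subvarieties KL) ?V"
    unfolding atom_of_def using V N T by (intro conjI bexI[of _ ?T]) (auto simp: subvarieties_def)
  show "\<not> (\<exists>B :: 'u rl. rl_algebra B \<and> finite (carrier B) \<and> generated_variety B = ?V)"
  proof
    assume "\<exists>B :: 'u rl. rl_algebra B \<and> finite (carrier B) \<and> generated_variety B = ?V"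
    then obtain B :: "'u rl"
      where B: "rl_algebra B" "finite (carrier B)" "generated_variety B = ?V" by blast
    have "B \<in> generated_variety B" by (auto simp: generated_variety_def)
    then interpret K_C_omega_model B using B(3) mem_generated_variety_K_C_omega by blast
    \<comment> \<open>As a finite member of the variety it generates, \<open>B\<close> is trivial;
      the variety it generates is then trivial too, contradicting \<open>N\<close>.\<close>
    have "carrier B = {\<one>\<^bsub>B\<^esub>}" using infinite_if_nontrivial B(2) by blast
    then have "B \<in> models {(Var 0, One)}" using B(1) by (simp add: models_trivial)
    then have "generated_variety B \<subseteq> ?T"
      unfolding generated_variety_def
      by (intro Inter_lower CollectI exI[of _ "{(Var 0, One)}"] conjI refl)
    then show False using N B(3) by blast
  qed
qed

end
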